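(* Let $\mathbb{G}$ be an $H$-type Iwasawa group, equipped with the distance $d(p,q)=\widetilde{d}(p^{-1}q)$ where $\widetilde{d}(x,t)=\left(|x|^4+16|t|^2\right)^{1/4}$ (extended to the one-point compactification $\widehat{\mathbb{G}}=\mathbb{G}\cup\{\infty\}$ by $d(p,\infty)=+\infty$ for $p\in\mathbb{G}$ and $d(\infty,\infty)=0$). Then the metric $d$ is Ptolemaean, and its Ptolemaean circles are $\mathbb{R}$-circles.
   Context: Let $\mathfrak{g}$ be a finite-dimensional real Lie algebra with an inner product $\langle\cdot,\cdot\rangle$, let $\mathfrak{j}$ be its center and $\mathfrak{b}$ the orthogonal complement of $\mathfrak{j}$. For $t\in\mathfrak{j}$ define $J_t:\mathfrak{b}\to\mathfrak{b}$ by $\langle J_t(x),y\rangle=\langle t,[x,y]\rangle$. $\mathfrak{g}$ is an $H$-type algebra if $[\mathfrak{b},\mathfrak{b}]=\mathfrak{j}$ and $J_t$ is orthogonal whenever $\langle t,t\rangle=1$. An $H$-type group is a connected, simply connected Lie group whose Lie algebra is $H$-type; it is an $H$-type Iwasawa group if for every $x\in\mathfrak{b}$ and all $t,t'\in\mathfrak{j}$ with $\langle t,t'\rangle=0$ there is $t''\in\mathfrak{j}$ with $J_t(J_{t'}(x))=J_{t''}(x)$. Points are written $p=\exp(x,t)$, identified with $(x,t)\in\mathfrak{b}\oplus\mathfrak{j}\cong\mathbb{R}^m\times\mathbb{R}^n$; the group law is $(x,t)(x',t')=(x+x',\,t+t'+\tfrac12[x,x'])$, and there are $m\times m$ skew-symmetric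 orthogonal matrices $U^1,\dots,U^n$ with $\tfrac12[x,x']=(\langle U^1x,x'\rangle,\dots,\langle U^nx,x'\rangle)$; $(x,t)^{-1}=(-x,-t)$. Dilations are $\delta_\lambda(x,t)=(\lambda x,\lambda^2t)$, $\lambda>0$. The inversion $\sigma:\mathbb{G}\setminus\{0\}\to\mathbb{G}\setminus\{0\}$ is $\sigma(x,t)=\left(-\frac{|x|^2x-4\sum_{k=1}^n U^kx}{|x|^4+16|t|^2},\,-\frac{t}{|x|^4+16|t|^2}\right)$, extended by $\sigma(0)=\infty$, $\sigma(\infty)=0$; left translations and dilations extend to $\widehat{\mathbb{G}}$ fixing $\infty$. The similarity group of $\widehat{\mathbb{G}}$ consists of compositions of left translations, dilations and $\sigma$. For $x\in\mathbb{R}^m\setminus\{0\}$ the standard $\mathbb{R}$-circle is $R_x=\{(\lambda x,0):\lambda\in\mathbb{R}\}$ (together with $\infty$); an $\mathbb{R}$-circle is the image of some $R_x$ under an element of the similarity group. A metric $d$ on a set $X$ is Ptolemaean if for any four distinct points $p_1,\dots,p_4\in X$ and any permutation $(i,j,k,l)$ of $(1,2,3,4)$: $d(p_i,p_k)d(p_j,p_l)\le d(p_i,p_j)d(p_k,p_l)+d(p_j,p_k)d(p_l,p_i)$. A subset $\Sigma\subset X$ is a Ptolemaean circle if for any four distinct points $p_1,p_2,p_3,p_4\in\Sigma$ such that $p_1,p_3$ separate $p_2,p_4$, one has $d(p_1,p_3)d(p_2,p_4)=d(p_1,p_2)d(p_3,p_4)+d(p_2,p_3)d(p_4,p_1)$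.
   Formalization: Proved with corrections: Ptolemaean circles are required to be homeomorphic to the circle (else single points qualify); [x,x'] (not ½[x,x']) has components ⟨U^k x,x'⟩, as J_t orthogonal demands; and the inversion uses 4∑ t_k U^k x in place of 4∑ U^k x. *)

theory Defs
  imports "HOL-Analysis.Analysis"
begin

text \<open>The Lie algebra is b + j = R^m + R^n (orthonormal coordinates). The bracket
  b x b -> j is encoded by matrices U k (k ranging over the index type of j):
  [x,y] = (<U^k x, y>)_k.  The group law is (x,t)(x',t') = (x+x', t+t'+1/2[x,x']).\<close>

type_synonym ('m, 'n) hpt = "(real^'m) \<times> (real^'n)"

definition hbr :: "('n::finite \<Rightarrow> real^'m::finite^'m) \<Rightarrow> real^'m \<Rightarrow> real^'m \<Rightarrow> real^'n" where
  "hbr U x y = (\<chi> k. (U k *v x) \<bullet> y)"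

text \<open>J_t defined by <J_t x, y> = <t, [x,y]>.\<close>
definition hJ :: "('n::finite \<Rightarrow> real^'m::finite^'m) \<Rightarrow> real^'n \<Rightarrow> real^'m \<Rightarrow> real^'m" where
  "hJ U t x = (\<chi> i. t \<bullet> hbr U x (axis i 1))"

definition htype :: "('n::finite \<Rightarrow> real^'m::finite^'m) \<Rightarrow> bool" where
  "htype U \<longleftrightarrow>
     (\<forall>k. transpose (U k) = - U k) \<and>
     span (range (\<lambda>(x, y). hbr U x y)) = UNIV \<and>
     (\<forall>t. norm t = 1 \<longrightarrow> orthogonal_transformation (hJ U t))"

definition htype_iwasawa :: "('n::finite \<Rightarrow> real^'m::finite^'m) \<Rightarrow> bool" where
  "htype_iwasawa U \<longleftrightarrow> htype U \<and>
     (\<forall>x t t'. t \<bullet> t' = 0 \<longrightarrow> (\<exists>t''. hJ U t (hJ U t' x) = hJ U t'' x))"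

definition hmul :: "('n::finite \<Rightarrow> real^'m::finite^'m) \<Rightarrow> ('m,'n) hpt \<Rightarrow> ('m,'n) hpt \<Rightarrow> ('m,'n) hpt" where
  "hmul U p q = (fst p + fst q, snd p + snd q + (1/2) *\<^sub>R hbr U (fst p) (fst q))"

definition hinv :: "('m::finite,'n::finite) hpt \<Rightarrow> ('m,'n) hpt" where
  "hinv p = (- fst p, - snd p)"

definition gauge :: "('m::finite,'n::finite) hpt \<Rightarrow> real" where
  "gauge p = (norm (fst p) ^ 4 + 16 * norm (snd p) ^ 2) powr (1/4)"

definition hdist :: "('n::finite \<Rightarrow> real^'m::finite^'m) \<Rightarrow> ('m,'n) hpt \<Rightarrow> ('m,'n) hpt \<Rightarrow> real" where
  "hdist U p q = gauge (hmul U (hinv p) q)"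

text \<open>The one-point compactification: None plays the role of the point at infinity.\<close>
definition hdG :: "('n::finite \<Rightarrow> real^'m::finite^'m) \<Rightarrow> ('m,'n) hpt option \<Rightarrow> ('m,'n) hpt option \<Rightarrow> ereal" where
  "hdG U p q = (case (p, q) of
       (Some a, Some b) \<Rightarrow> ereal (hdist U a b)
     | (None, None) \<Rightarrow> 0
     | _ \<Rightarrow> \<infinity>)"

text \<open>Standard convention for extended metrics: in the Ptolemy relation, factors
  d(p, infinity) = +infinity cancel; this is implemented by replacing them by 1.\<close>
definition dreg :: "('a \<Rightarrow> 'a \<Rightarrow> ereal) \<Rightarrow> 'a \<Rightarrow> 'a \<Rightarrow> real" where
  "dreg d x y = (if d x y = \<infinity> then 1 else real_of_ereal (d x y))"

definition ptolemaean :: "('a \<Rightarrow> 'a \<Rightarrow> ereal) \<Rightarrow> 'a set \<Rightarrow> bool" where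
  "ptolemaean d X \<longleftrightarrow>
     (\<forall>a\<in>X. \<forall>b\<in>X. \<forall>c\<in>X. \<forall>e\<in>X. distinct [a, b, c, e] \<longrightarrow>
        dreg d a c * dreg d b e \<le> dreg d a b * dreg d c e + dreg d b c * dreg d e a)"

definition hat_top :: "'a::topological_space option topology" where
  "hat_top = topology (\<lambda>V. open (Some -` V) \<and> (None \<in> V \<longrightarrow> compact (- (Some -` V))))"

definition is_circle :: "'a::topological_space option set \<Rightarrow> bool" where
  "is_circle S \<longleftrightarrow> subtopology hat_top S homeomorphic_space top_of_set (sphere (0::complex) 1)"

definition separates :: "'a::topological_space option set \<Rightarrow> 'a option \<Rightarrow> 'a option \<Rightarrow> 'a option \<Rightarrow> 'a option \<Rightarrow> bool" where
  "separates S a c b e \<longleftrightarrow>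
     \<not> (\<exists>C. connectedin hat_top C \<and> C \<subseteq> S - {a, c} \<and> b \<in> C \<and> e \<in> C)"

definition ptolemaean_circle :: "('a::topological_space option \<Rightarrow> 'a option \<Rightarrow> ereal) \<Rightarrow> 'a option set \<Rightarrow> bool" where
  "ptolemaean_circle d S \<longleftrightarrow> is_circle S \<and>
     (\<forall>p1\<in>S. \<forall>p2\<in>S. \<forall>p3\<in>S. \<forall>p4\<in>S. distinct [p1, p2, p3, p4] \<and> separates S p1 p3 p2 p4 \<longrightarrow>
        dreg d p1 p3 * dreg d p2 p4 = dreg d p1 p2 * dreg d p3 p4 + dreg d p2 p3 * dreg d p4 p1)"

definition hlt :: "('n::finite \<Rightarrow> real^'m::finite^'m) \<Rightarrow> ('m,'n) hpt \<Rightarrow> ('m,'n) hpt option \<Rightarrow> ('m,'n) hpt option" where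
  "hlt U g = map_option (hmul U g)"

definition hdil :: "real \<Rightarrow> ('m::finite,'n::finite) hpt option \<Rightarrow> ('m,'n) hpt option" where
  "hdil l = map_option (\<lambda>(x, t). (l *\<^sub>R x, l\<^sup>2 *\<^sub>R t))"

definition hsig :: "('n::finite \<Rightarrow> real^'m::finite^'m) \<Rightarrow> ('m,'n) hpt option \<Rightarrow> ('m,'n) hpt option" where
  "hsig U p = (case p of
       None \<Rightarrow> Some (0, 0)
     | Some (x, t) \<Rightarrow>
         (if (x, t) = (0, 0) then None
          else Some (- ((1 / (norm x ^ 4 + 16 * norm t ^ 2)) *\<^sub>R
                         (norm x ^ 2 *\<^sub>R x - 4 *\<^sub>R (\<Sum>k\<in>UNIV. t $ k *\<^sub>R (U k *v x)))),
                     - ((1 / (norm x ^ 4 + 16 * norm t ^ 2)) *\<^sub>R t))))"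

inductive_set simgrp :: "('n::finite \<Rightarrow> real^'m::finite^'m) \<Rightarrow> (('m,'n) hpt option \<Rightarrow> ('m,'n) hpt option) set"
  for U where
    sim_id: "id \<in> simgrp U"
  | sim_lt: "f \<in> simgrp U \<Longrightarrow> hlt U g \<circ> f \<in> simgrp U"
  | sim_dil: "f \<in> simgrp U \<Longrightarrow> l > 0 \<Longrightarrow> hdil l \<circ> f \<in> simgrp U"
  | sim_sig: "f \<in> simgrp U \<Longrightarrow> hsig U \<circ> f \<in> simgrp U"

definition std_Rcircle :: "real^'m::finite \<Rightarrow> ('m,'n::finite) hpt option set" where
  "std_Rcircle x = insert None {Some (l *\<^sub>R x, 0) | l. True}"

definition R_circle :: "('n::finite \<Rightarrow> real^'m::finite^'m) \<Rightarrow> ('m,'n) hpt option set \<Rightarrow> bool" where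
  "R_circle U S \<longleftrightarrow> (\<exists>f\<in>simgrp U. \<exists>x. x \<noteq> 0 \<and> S = f ` std_Rcircle x)"

end

theory Submission
  imports Defs
begin

text \<open>
  The inversion satisfies d(\<sigma> p, \<sigma> q) = d(p, q) / (|p| |q|), where |p| = d(0, p), so after
  translating one point to the origin Ptolemy's inequality becomes the triangle inequality for the
  inverted remaining three points. Given a Ptolemaean circle, send one of its points to infinity by
  a similarity: Ptolemy's equality then says that the image is an unbounded geodesic in both
  directions. Equality in the triangle inequality forces three points onto a left translate of a
  horizontal line, so the image of the circle is a left translate of a standard R-circle.
\<close>

text \<open>The square of the gauge of (x,t) is the Euclidean norm of (|x|^2, 4t), and under the
  group law these vectors add, apart from the correction 2(<x,y>, [x,y]). The metric is thus
  governed by \<open>hform\<close>, the squared norm of (<x,y>, [x,y]), which equals |x|^2 times the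
  squared length of the projection of y onto the span of x and all J_t x. Its bound |x|^2 |y|^2
  gives the triangle inequality and decides the equality case. The obstacle is the inversion
  formula. Expanding d^4 leaves terms that scale by virtue of J_t^2 = -|t|^2, and one
  \<open>hform\<close> term, whose scaling is obtained from the projection commuting with |x|^2 - 4
  J_t. For this the span has to be stable under every J_s, and here the Iwasawa condition enters.
  For the circles, equality on triples only places the image inside a line. That it fills the line
  comes from the base point: approaching it from its two sides makes the linear coordinate unbounded
  in opposite directions.\<close>

section \<open>Bilinear structure and the gauge\<close>

lemma hJ_eq_sum: "hJ U t x = (\<Sum>k\<in>UNIV. t $ k *\<^sub>R (U k *v x))"
  unfolding hJ_def inner_vec_def[of t] hbr_def
  by (simp add: vec_eq_iff inner_axis)

lemma hJ_inner: "hJ U t x \<bullet> y = t \<bullet> hbr U x y"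
  unfolding hJ_eq_sum inner_vec_def[of t] hbr_def
  by (simp add: inner_sum_left)

lemma bounded_bilinear_hbr: "bounded_bilinear (hbr U)"
  unfolding bilinear_conv_bounded_bilinear[symmetric] bilinear_def
  by (auto intro!: linearI simp: hbr_def vec_eq_iff inner_add_left inner_add_right
        matrix_vector_right_distrib matrix_vector_mult_scaleR)

lemma bounded_bilinear_hJ: "bounded_bilinear (hJ U)"
  unfolding bilinear_conv_bounded_bilinear[symmetric] bilinear_def
  by (auto intro!: linearI simp: hJ_eq_sum matrix_vector_right_distrib
        matrix_vector_mult_scaleR scaleR_add_left scaleR_add_right sum.distrib scaleR_sum_right
        mult.commute)

text \<open>Nested square roots replace \<open>powr\<close>: continuity and the evaluation of
  squares and fourth powers then come from \<open>sqrt\<close>.\<close>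

lemma gauge_eq_sqrt: "gauge p = sqrt (sqrt (norm (fst p) ^ 4 + 16 * norm (snd p) ^ 2))"
proof -
  let ?a = "norm (fst p) ^ 4 + 16 * norm (snd p) ^ 2"
  have "?a powr (1/4) = (?a powr (1/2)) powr (1/2)"
    by (simp only: powr_powr) simp
  then show ?thesis
    by (simp add: gauge_def powr_half_sqrt)
qed

lemma gauge_nonneg [simp]: "0 \<le> gauge p"
  by (simp add: gauge_eq_sqrt)

text \<open>The 4 is the root of 16. Estimates of the gauge become estimates of the norm of R x
  R^n.\<close>

lemma gauge_power2: "(gauge p)\<^sup>2 = norm ((norm (fst p))\<^sup>2, 4 *\<^sub>R snd p)"
  by (simp add: gauge_eq_sqrt norm_Pair power_mult_distrib)

lemma gauge_power4: "gauge p ^ 4 = norm (fst p) ^ 4 + 16 * norm (snd p) ^ 2"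
proof -
  have "gauge p ^ 4 = ((gauge p)\<^sup>2)\<^sup>2"
    by simp
  then show ?thesis
    by (simp add: gauge_eq_sqrt)
qed

lemma gauge_eq_0_iff [simp]: "gauge p = 0 \<longleftrightarrow> p = 0"
  by (auto simp: gauge_eq_sqrt add_nonneg_eq_0_iff prod_eq_iff)

lemma gauge_0 [simp]: "gauge 0 = 0"
  by simp

lemma gauge_pos_iff [simp]: "0 < gauge p \<longleftrightarrow> p \<noteq> 0"
  using gauge_nonneg[of p] gauge_eq_0_iff[of p] by linarith

lemma norm_fst_le_gauge: "norm (fst p) \<le> gauge p"
  by (rule power_le_imp_le_base[where n = 3]) (simp_all add: gauge_power4)

lemma gauge_scaleR_fst: "gauge (c *\<^sub>R x, 0) = \<bar>c\<bar> * norm x"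
proof -
  have "gauge (c *\<^sub>R x, 0) ^ 4 = (\<bar>c\<bar> * norm x) ^ 4"
    by (simp add: gauge_power4)
  then show ?thesis
    by (rule power_eq_imp_eq_base) auto
qed

lemma continuous_on_gauge [continuous_intros]:
  "continuous_on A f \<Longrightarrow> continuous_on A (\<lambda>x. gauge (f x))"
  unfolding gauge_eq_sqrt by (intro continuous_intros)

text \<open>Complements of these sets give neighbourhoods of \<open>None\<close> in
  \<open>hat_top\<close>; through them, convergence to infinity becomes unboundedness of the
  gauge.\<close>

lemma compact_gauge_le: "compact {p :: ('m::finite,'n::finite) hpt. gauge p \<le> M}"
proof -
  have "closed {p :: ('m,'n) hpt. gauge p \<le> M}"
    by (intro closed_Collect_le continuous_intros)
  moreover have "bounded {p :: ('m,'n) hpt. gauge p \<le> M}"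
  proof (rule boundedI)
    fix p :: "('m,'n) hpt" assume "p \<in> {p. gauge p \<le> M}"
    then have *: "gauge p \<le> M" by simp
    have "4 * norm (snd p) \<le> norm ((norm (fst p))\<^sup>2, 4 *\<^sub>R snd p)"
      using norm_snd_le[of "4 *\<^sub>R snd p" "(norm (fst p))\<^sup>2"] by simp
    also have "\<dots> \<le> M\<^sup>2"
      using * by (simp add: gauge_power2[symmetric] power_mono)
    finally have "norm (snd p) \<le> M\<^sup>2" by (smt (verit) norm_ge_zero)
    moreover have "norm (fst p) \<le> M"
      using norm_fst_le_gauge[of p] * by linarith
    ultimately show "norm p \<le> M + M\<^sup>2"
      using norm_Pair_le[of "fst p" "snd p"] by simp
  qed
  ultimately show ?thesis
    by (simp add: compact_eq_bounded_closed)
qed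

section \<open>The inversion on finite points\<close>

text \<open>The horizontal numerator of sigma, (|x|^2 - 4 J_t) x. For H-type \<open>U\<close> the
  linear map |x|^2 - 4 J_t multiplies lengths by the squared gauge of (x,t), J_t being skew with
  J_t^2 = -|t|^2.\<close>

definition twist :: "('n::finite \<Rightarrow> real^'m::finite^'m) \<Rightarrow> ('m,'n) hpt \<Rightarrow> real^'m" where
  "twist U p = (norm (fst p))\<^sup>2 *\<^sub>R fst p - 4 *\<^sub>R hJ U (snd p) (fst p)"

text \<open>At 0 the division by zero yields 0 instead of infinity, hence the assumption
  \<open>p \<noteq> 0\<close> in the facts about it.\<close>

definition inversion :: "('n::finite \<Rightarrow> real^'m::finite^'m) \<Rightarrow> ('m,'n) hpt \<Rightarrow> ('m,'n) hpt" where
  "inversion U p = (- ((1 / gauge p ^ 4) *\<^sub>R twist U p), - ((1 / gauge p ^ 4) *\<^sub>R snd p))"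

lemma hsig_Some: "hsig U (Some p) = (if p = 0 then None else Some (inversion U p))"
  by (cases p) (simp add: hsig_def inversion_def twist_def gauge_power4 hJ_eq_sum zero_prod_def)

lemma continuous_on_inversion:
  assumes "continuous_on A f" "\<And>x. x \<in> A \<Longrightarrow> f x \<noteq> 0"
  shows "continuous_on A (\<lambda>x. inversion U (f x))"
  unfolding inversion_def twist_def
  by (intro continuous_intros bounded_bilinear.continuous_on[OF bounded_bilinear_hJ] assms)
     (auto simp: assms)

lemma continuous_on_hmul [continuous_intros]:
  assumes "continuous_on A f" "continuous_on A g"
  shows "continuous_on A (\<lambda>x. hmul U (f x) (g x))"
  unfolding hmul_def
  by (intro continuous_intros bounded_bilinear.continuous_on[OF bounded_bilinear_hbr] assms)

section \<open>Topology of the one-point compactification and its circles\<close>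

text \<open>\<open>hat_top\<close> is introduced through \<open>topology\<close>, so its open sets
  can be read off only once the axioms are checked. For a union containing \<open>None\<close>, the
  complement is a closed subset of the compact complement of one member.\<close>

lemma openin_hat_top:
  fixes V :: "'a::t2_space option set"
  shows "openin hat_top V \<longleftrightarrow> open (Some -` V) \<and> (None \<in> V \<longrightarrow> compact (- (Some -` V)))"
proof -
  have "istopology (\<lambda>V :: 'a option set. open (Some -` V) \<and> (None \<in> V \<longrightarrow> compact (- (Some -` V))))"
    unfolding istopology_def
  proof (intro conjI allI impI)
    fix S T :: "'a option set"
    assume "open (Some -` S) \<and> (None \<in> S \<longrightarrow> compact (- (Some -` S)))"
      and "open (Some -` T) \<and> (None \<in> T \<longrightarrow> compact (- (Some -` T)))"
    then show "open (Some -` (S \<inter> T))" "None \<in> S \<inter> T \<Longrightarrow> compact (- (Some -` (S \<inter> T)))"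
      by (auto simp: vimage_Int intro: compact_Un)
  next
    fix K :: "'a option set set"
    assume K: "\<forall>V\<in>K. open (Some -` V) \<and> (None \<in> V \<longrightarrow> compact (- (Some -` V)))"
    then show o: "open (Some -` \<Union>K)"
      by (auto simp: vimage_Union)
    assume "None \<in> \<Union>K"
    then obtain V where "V \<in> K" "None \<in> V" by blast
    then have "compact (- (Some -` V) \<inter> - (Some -` \<Union>K))"
      using K o by (intro compact_Int_closed) (auto simp: closed_Compl)
    moreover have "- (Some -` V) \<inter> - (Some -` \<Union>K) = - (Some -` \<Union>K)"
      using \<open>V \<in> K\<close> by auto
    ultimately show "compact (- (Some -` \<Union>K))" by simp
  qed
  then show ?thesis
    by (simp add: hat_top_def)
qed

lemma topspace_hat_top: "topspace (hat_top :: 'a::t2_space option topology) = UNIV"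
  using openin_subset[of hat_top "UNIV :: 'a option set"] by (auto simp: openin_hat_top)

lemma openin_hat_top_Some: "open V \<Longrightarrow> openin hat_top (Some ` (V :: 'a::t2_space set))"
  by (auto simp: openin_hat_top inj_vimage_image_eq)

lemma openin_hat_top_compact: "compact K \<Longrightarrow> openin hat_top (- Some ` (K :: 'a::t2_space set))"
  by (auto simp: openin_hat_top vimage_Compl inj_vimage_image_eq compact_imp_closed)

lemma continuous_on_the_hat_top:
  fixes \<gamma> :: "'b::topological_space \<Rightarrow> 'a::t2_space option"
  assumes "continuous_map (top_of_set A) hat_top \<gamma>" "B \<subseteq> A" "\<And>x. x \<in> B \<Longrightarrow> \<gamma> x \<noteq> None"
  shows "continuous_on B (\<lambda>x. the (\<gamma> x))"
proof -
  have B: "continuous_map (top_of_set B) hat_top \<gamma>"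
    using assms(1,2) by (rule continuous_map_from_subtopology_mono)
  have "openin (top_of_set B) {x \<in> B. the (\<gamma> x) \<in> V}" if "open V" for V
  proof -
    have "{x \<in> B. the (\<gamma> x) \<in> V} = {x \<in> B. \<gamma> x \<in> Some ` V}"
      using assms(3) by force
    then show ?thesis
      using openin_continuous_map_preimage[OF B openin_hat_top_Some[OF that]] by simp
  qed
  then have "continuous_map (top_of_set B) euclidean (\<lambda>x. the (\<gamma> x))"
    by (simp add: continuous_map_def)
  then show ?thesis by simp
qed

text \<open>Continuity at the two ends of an interval in filter form; both ends will be sent to the
  base point of a circle.\<close>

lemma continuous_map_interval_eventually:
  fixes \<gamma> :: "real \<Rightarrow> 'a"
  assumes "continuous_map (top_of_set {l..u}) Y \<gamma>" "openin Y V" "l < u"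
  shows "\<gamma> l \<in> V \<Longrightarrow> eventually (\<lambda>t. \<gamma> t \<in> V) (at_right l)"
    and "\<gamma> u \<in> V \<Longrightarrow> eventually (\<lambda>t. \<gamma> t \<in> V) (at_left u)"
proof -
  have "openin (top_of_set {l..u}) {t \<in> {l..u}. \<gamma> t \<in> V}"
    using openin_continuous_map_preimage[OF assms(1,2)] by simp
  then obtain T where "open T" "{t \<in> {l..u}. \<gamma> t \<in> V} = {l..u} \<inter> T"
    unfolding openin_open by blast
  then have T: "open T" "\<And>t. l \<le> t \<Longrightarrow> t \<le> u \<Longrightarrow> \<gamma> t \<in> V \<longleftrightarrow> t \<in> T"
    by (auto simp: set_eq_iff)
  show "eventually (\<lambda>t. \<gamma> t \<in> V) (at_right l)" if "\<gamma> l \<in> V"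
  proof -
    have "l \<in> T" using T(2) that assms(3) by auto
    then have "eventually (\<lambda>t. t \<in> T) (at_right l)"
      using T(1) unfolding eventually_at_topological by blast
    then show ?thesis
      using eventually_at_right_real[OF assms(3)]
      by eventually_elim (use T(2) in auto)
  qed
  show "eventually (\<lambda>t. \<gamma> t \<in> V) (at_left u)" if "\<gamma> u \<in> V"
  proof -
    have "u \<in> T" using T(2) that assms(3) by auto
    then have "eventually (\<lambda>t. t \<in> T) (at_left u)"
      using T(1) unfolding eventually_at_topological by blast
    then show ?thesis
      using eventually_at_left_real[OF assms(3)]
      by eventually_elim (use T(2) in auto)
  qed
qed

text \<open>The parameter is the angle from \<open>a\<close>, which is met at both ends 0 and 2 pi.
  On \<open>S - {a}\<close> the angle is continuous, so a connected subset has a connected set of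
  angles: containing r and t, it contains s.\<close>

lemma circle_parametrization:
  fixes S :: "'a::t2_space option set"
  assumes "is_circle S" "a \<in> S"
  obtains \<gamma> where "continuous_map (top_of_set {0..2*pi}) hat_top \<gamma>" "\<gamma> 0 = a" "\<gamma> (2*pi) = a"
    "inj_on \<gamma> {0<..<2*pi}" "\<gamma> ` {0<..<2*pi} = S - {a}"
    "\<And>r s t. \<lbrakk>0 < r; r < s; s < t; t < 2*pi\<rbrakk> \<Longrightarrow> separates S a (\<gamma> s) (\<gamma> r) (\<gamma> t)"
proof -
  obtain h g where hg: "homeomorphic_maps (subtopology hat_top S) (top_of_set (sphere (0::complex) 1)) h g"
    using assms(1) by (auto simp: is_circle_def homeomorphic_space_def)
  have ch: "continuous_map (subtopology hat_top S) (top_of_set (sphere (0::complex) 1)) h"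
    and cg: "continuous_map (top_of_set (sphere (0::complex) 1)) (subtopology hat_top S) g"
    and gh: "\<And>p. p \<in> S \<Longrightarrow> g (h p) = p" and hgz: "\<And>z. norm z = 1 \<Longrightarrow> h (g z) = z"
    using hg by (auto simp: homeomorphic_maps_def topspace_hat_top)
  have hS: "norm (h p) = 1" if "p \<in> S" for p
    using continuous_map_image_subset_topspace[OF ch] that by (auto simp: topspace_hat_top)
  have gS: "g z \<in> S" if "norm z = 1" for z
    using continuous_map_image_subset_topspace[OF cg] that by (auto simp: topspace_hat_top)
  define w where "w = h a"
  have w: "norm w = 1" "w \<noteq> 0"
    using hS[OF assms(2)] by (auto simp: w_def)
  define \<gamma> where "\<gamma> = (\<lambda>t. g (w * cis t))"
  \<comment> \<open>Dividing by \<open>w = h a\<close> rotates the image of \<open>a\<close> to 1,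
    so the cut of \<open>Arg2pi\<close> along the nonnegative reals meets the circle only
    there.\<close>
  define \<phi> where "\<phi> = (\<lambda>p. Arg2pi (h p / w))"
  have nw: "norm (w * cis t) = 1" for t
    by (simp add: norm_mult w)
  have h\<gamma>: "h (\<gamma> t) = w * cis t" for t
    by (simp add: \<gamma>_def hgz nw)
  have \<phi>\<gamma>: "\<phi> (\<gamma> t) = t" if "0 < t" "t < 2*pi" for t
    unfolding \<phi>_def h\<gamma> using w that
    by (intro Arg2pi_unique[of 1]) (auto simp: cis_conv_exp)
  have \<gamma>\<phi>: "\<gamma> (\<phi> p) = p" if "p \<in> S" for p
  proof -
    have n: "norm (h p / w) = 1"
      by (simp add: norm_divide hS that w)
    then have "h p / w = cis (\<phi> p)"
      using Arg2pi_eq[of "h p / w"] by (simp add: \<phi>_def cis_conv_exp)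
    then have "w * cis (\<phi> p) = h p"
      using w by (simp add: field_simps)
    then show ?thesis
      by (simp add: \<gamma>_def gh that)
  qed
  have \<gamma>S: "\<gamma> t \<in> S" for t
    by (simp add: \<gamma>_def gS nw)
  have \<gamma>a: "\<gamma> 0 = a" "\<gamma> (2*pi) = a"
    by (simp_all add: \<gamma>_def w_def gh assms)
  have \<phi>pos: "0 < \<phi> p" "\<phi> p < 2*pi" "h p / w \<notin> \<real>\<^sub>\<ge>\<^sub>0" if "p \<in> S - {a}" for p
  proof -
    have "\<phi> p \<noteq> 0"
      using \<gamma>\<phi>[of p] \<gamma>a that by auto
    then show "0 < \<phi> p" "\<phi> p < 2*pi"
      using Arg2pi_ge_0[of "h p / w"] Arg2pi_lt_2pi[of "h p / w"] by (auto simp: \<phi>_def)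
    show "h p / w \<notin> \<real>\<^sub>\<ge>\<^sub>0"
      using \<open>\<phi> p \<noteq> 0\<close> unfolding \<phi>_def Arg2pi_eq_0 by (auto simp: complex_nonneg_Reals_iff complex_is_Real_iff)
  qed
  have img: "\<gamma> ` {0<..<2*pi} = S - {a}"
  proof
    show "\<gamma> ` {0<..<2*pi} \<subseteq> S - {a}"
    proof clarify
      fix t :: real assume t: "t \<in> {0<..<2*pi}"
      then have "\<phi> (\<gamma> t) \<noteq> 0" using \<phi>\<gamma>[of t] by auto
      moreover have "\<phi> a = 0" using w(2) Arg2pi_of_real[of 1] by (simp add: \<phi>_def w_def[symmetric])
      ultimately show "\<gamma> t \<in> S - {a}" using \<gamma>S by auto
    qed
    show "S - {a} \<subseteq> \<gamma> ` {0<..<2*pi}"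
    proof
      fix p assume p: "p \<in> S - {a}"
      then show "p \<in> \<gamma> ` {0<..<2*pi}"
        using \<phi>pos[OF p] \<gamma>\<phi>[of p] by (intro image_eqI[of _ _ "\<phi> p"]) auto
    qed
  qed
  show ?thesis
  proof (rule that[of \<gamma>])
    have "continuous_map (top_of_set {0..2*pi}) (top_of_set (sphere (0::complex) 1)) (\<lambda>t. w * cis t)"
      by (auto simp: continuous_map_in_subtopology norm_mult w intro!: continuous_intros)
    from continuous_map_compose[OF this cg]
    show "continuous_map (top_of_set {0..2*pi}) hat_top \<gamma>"
      by (simp add: continuous_map_in_subtopology \<gamma>_def o_def)
    show "inj_on \<gamma> {0<..<2*pi}"
      by (rule inj_on_inverseI[of _ \<phi>]) (simp add: \<phi>\<gamma>)
    fix r s t :: real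
    assume rst: "0 < r" "r < s" "s < t" "t < 2*pi"
    show "separates S a (\<gamma> s) (\<gamma> r) (\<gamma> t)"
      unfolding separates_def
    proof clarify
      fix C assume C: "connectedin hat_top C" "C \<subseteq> S - {a, \<gamma> s}" "\<gamma> r \<in> C" "\<gamma> t \<in> C"
      have "connectedin (subtopology hat_top S) C"
        using C by (auto simp: connectedin_subtopology)
      then have "connectedin (top_of_set (sphere (0::complex) 1)) (h ` C)"
        by (rule connectedin_continuous_map_image[OF ch])
      then have "connected (h ` C)"
        by (simp add: connectedin_subtopology)
      moreover have "continuous_on (h ` C) (\<lambda>z. Arg2pi (z / w))"
      proof (rule continuous_at_imp_continuous_on, clarify)
        fix p assume "p \<in> C"
        then have "h p / w \<notin> \<real>\<^sub>\<ge>\<^sub>0" using \<phi>pos(3)[of p] C(2) by auto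
        then have "isCont Arg2pi (h p / w)" by (rule continuous_at_Arg2pi)
        then show "isCont (\<lambda>z. Arg2pi (z / w)) (h p)"
          by (intro isCont_o2[where f = "\<lambda>z. z / w" and g = Arg2pi] continuous_intros) (use w in auto)
      qed
      ultimately have "connected ((\<lambda>z. Arg2pi (z / w)) ` h ` C)"
        by (rule connected_continuous_image[rotated])
      then have "connected (\<phi> ` C)"
        by (simp add: \<phi>_def image_image)
      moreover have "r \<in> \<phi> ` C" "t \<in> \<phi> ` C"
        using C(3,4) \<phi>\<gamma>[of r] \<phi>\<gamma>[of t] rst by (metis image_eqI less_trans)+
      ultimately have "s \<in> \<phi> ` C"
        using rst by (meson connectedD_interval less_imp_le)
      then obtain p where "p \<in> C" "\<phi> p = s" by blast
      then show False
        using \<gamma>\<phi>[of p] C(2) by auto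
    qed
  qed (use \<gamma>a img in auto)
qed

section \<open>Identities for J_t in an H-type algebra\<close>

locale iwasawa =
  fixes U :: "'n::finite \<Rightarrow> real^'m::finite^'m"
  assumes htype_iwasawa: "htype_iwasawa U"
begin

interpretation hbr: bounded_bilinear "hbr U"
  by (rule bounded_bilinear_hbr)

interpretation hJ: bounded_bilinear "hJ U"
  by (rule bounded_bilinear_hJ)

lemma hbr_commute: "hbr U y x = - hbr U x y"
proof -
  have "(U k *v y) \<bullet> x = - ((U k *v x) \<bullet> y)" for k
  proof -
    have t: "transpose (U k) = - U k"
      using htype_iwasawa by (simp add: htype_iwasawa_def htype_def)
    have "(U k *v y) \<bullet> x = y \<bullet> (transpose (U k) *v x)"
      by (metis dot_lmul_matrix inner_commute transpose_matrix_vector transpose_transpose)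
    also have "\<dots> = - ((U k *v x) \<bullet> y)"
      unfolding t by (simp add: inner_commute matrix_vector_mult_def inner_vec_def sum_negf)
    finally show ?thesis .
  qed
  then show ?thesis
    by (simp add: hbr_def vec_eq_iff)
qed

lemma hbr_self [simp]: "hbr U x x = 0"
  using hbr_commute[of x x] by (simp add: vec_eq_iff)

lemma hJ_skew: "hJ U t x \<bullet> y = - (x \<bullet> hJ U t y)"
  using hbr_commute[of x y] by (simp add: hJ_inner inner_commute[of x])

lemma inner_hJ_self [simp]: "hJ U t x \<bullet> x = 0" "x \<bullet> hJ U t x = 0"
  by (simp_all add: hJ_inner inner_commute[of x])

lemma norm_hJ: "norm (hJ U t x) = norm t * norm x"
proof (cases "t = 0")
  case True
  then show ?thesis by (simp add: hJ.zero_left)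
next
  case False
  then have "orthogonal_transformation (hJ U (t /\<^sub>R norm t))"
    using htype_iwasawa by (simp add: htype_iwasawa_def htype_def)
  then have "norm (hJ U (t /\<^sub>R norm t) x) = norm x"
    by (simp add: orthogonal_transformation)
  then show ?thesis
    using False by (simp add: hJ.scaleR_left field_simps)
qed

text \<open>Polarization of \<open>norm_hJ\<close> in the index; polarizing in the vector gives
  \<open>inner_hJ_hJ'\<close> and, with skewness, the Clifford relation
  \<open>hJ_hJ_same\<close>.\<close>

lemma inner_hJ_hJ: "hJ U s x \<bullet> hJ U t x = (s \<bullet> t) * (norm x)\<^sup>2"
proof -
  have "(norm (hJ U s x + hJ U t x))\<^sup>2 = (norm (s + t) * norm x)\<^sup>2"
    by (simp add: norm_hJ hJ.add_left[symmetric])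
  moreover have "(norm (hJ U s x))\<^sup>2 = (norm s * norm x)\<^sup>2" "(norm (hJ U t x))\<^sup>2 = (norm t * norm x)\<^sup>2"
    by (simp_all add: norm_hJ)
  ultimately show ?thesis
    by (simp add: power2_norm_eq_inner power_mult_distrib inner_add_left inner_add_right
        inner_commute algebra_simps)
qed

lemma inner_hJ_hJ': "hJ U t x \<bullet> hJ U t y = (norm t)\<^sup>2 * (x \<bullet> y)"
proof -
  have "(norm (hJ U t x + hJ U t y))\<^sup>2 = (norm t * norm (x + y))\<^sup>2"
    by (simp add: norm_hJ hJ.add_right[symmetric])
  moreover have "(norm (hJ U t x))\<^sup>2 = (norm t * norm x)\<^sup>2" "(norm (hJ U t y))\<^sup>2 = (norm t * norm y)\<^sup>2"
    by (simp_all add: norm_hJ)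
  ultimately show ?thesis
    by (simp add: power2_norm_eq_inner power_mult_distrib inner_add_left inner_add_right
        inner_commute algebra_simps)
qed

lemma hJ_hJ_same: "hJ U t (hJ U t x) = - ((norm t)\<^sup>2 *\<^sub>R x)"
proof (rule vector_eq_rdot[THEN iffD1], rule allI)
  fix y
  show "hJ U t (hJ U t x) \<bullet> y = - ((norm t)\<^sup>2 *\<^sub>R x) \<bullet> y"
    using inner_hJ_hJ'[of t x y] by (simp add: hJ_skew[of t "hJ U t x"])
qed

lemma hbr_hJ: "hbr U x (hJ U s x) = (norm x)\<^sup>2 *\<^sub>R s"
proof (rule vector_eq_ldot[THEN iffD1], rule allI)
  fix t
  show "t \<bullet> hbr U x (hJ U s x) = t \<bullet> (norm x)\<^sup>2 *\<^sub>R s"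
    by (simp add: hJ_inner[symmetric] inner_hJ_hJ)
qed

section \<open>The span of x and all J_t x, and the form it defines\<close>

text \<open>Already a subspace, because J_t x is linear in t; the explicit form exposes the
  coefficients c and s.\<close>

definition Jspan :: "real^'m \<Rightarrow> (real^'m) set" where
  "Jspan x = {c *\<^sub>R x + hJ U s x |c s. True}"

lemma JspanI: "c *\<^sub>R x + hJ U s x \<in> Jspan x"
  by (auto simp: Jspan_def)

lemma Jspan_hJ_self: "hJ U s x \<in> Jspan x"
  using JspanI[of 0 x s] by simp

lemma Jspan_add: "u \<in> Jspan x \<Longrightarrow> v \<in> Jspan x \<Longrightarrow> u + v \<in> Jspan x"
proof -
  assume "u \<in> Jspan x" "v \<in> Jspan x"
  then obtain a s b t where "u = a *\<^sub>R x + hJ U s x" "v = b *\<^sub>R x + hJ U t x"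
    by (auto simp: Jspan_def)
  then have "u + v = (a + b) *\<^sub>R x + hJ U (s + t) x"
    by (simp add: hJ.add_left algebra_simps)
  then show ?thesis by (simp add: JspanI)
qed

lemma Jspan_scaleR: "u \<in> Jspan x \<Longrightarrow> b *\<^sub>R u \<in> Jspan x"
proof -
  assume "u \<in> Jspan x"
  then obtain a s where "u = a *\<^sub>R x + hJ U s x"
    by (auto simp: Jspan_def)
  then have "b *\<^sub>R u = (b * a) *\<^sub>R x + hJ U (b *\<^sub>R s) x"
    by (simp add: hJ.scaleR_left algebra_simps)
  then show ?thesis by (simp add: JspanI)
qed

text \<open>The Iwasawa condition concerns orthogonal indices. The component of t along t' is
  handled by \<open>hJ_hJ_same\<close>, the remaining component by the condition itself.\<close>

lemma hJ_hJ_in_Jspan: "hJ U t (hJ U t' x) \<in> Jspan x"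
proof (cases "t' = 0")
  case True
  then show ?thesis
    using JspanI[of 0 x 0] by (simp add: hJ.zero_left hJ.zero_right)
next
  case False
  define c where "c = (t \<bullet> t') / (t' \<bullet> t')"
  define r where "r = t - c *\<^sub>R t'"
  have "r \<bullet> t' = 0"
    using False by (simp add: r_def c_def inner_diff_left)
  then obtain t'' where t'': "hJ U r (hJ U t' x) = hJ U t'' x"
    using htype_iwasawa by (meson htype_iwasawa_def)
  have "t = c *\<^sub>R t' + r"
    by (simp add: r_def)
  then have "hJ U t (hJ U t' x) = c *\<^sub>R hJ U t' (hJ U t' x) + hJ U t'' x"
    by (simp add: hJ.add_left hJ.scaleR_left t'')
  then have "hJ U t (hJ U t' x) = (- c * (norm t')\<^sup>2) *\<^sub>R x + hJ U t'' x"
    by (simp add: hJ_hJ_same)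
  then show ?thesis
    using JspanI by metis
qed

lemma hJ_Jspan: "v \<in> Jspan x \<Longrightarrow> hJ U t v \<in> Jspan x"
proof -
  assume "v \<in> Jspan x"
  then obtain a s where "v = a *\<^sub>R x + hJ U s x"
    by (auto simp: Jspan_def)
  then have "hJ U t v = a *\<^sub>R hJ U t x + hJ U t (hJ U s x)"
    by (simp add: hJ.add_right hJ.scaleR_right)
  then show ?thesis
    by (simp add: Jspan_add Jspan_scaleR Jspan_hJ_self hJ_hJ_in_Jspan)
qed

text \<open>The analogue of the squared modulus of a Hermitian product: |x|^2 times the squared
  length of the projection of y onto \<open>Jspan x\<close>.\<close>

definition hform :: "real^'m \<Rightarrow> real^'m \<Rightarrow> real" where
  "hform x y = (x \<bullet> y)\<^sup>2 + (norm (hbr U x y))\<^sup>2"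

lemma hform_commute: "hform x y = hform y x"
  by (simp add: hform_def hbr_commute[of x y] inner_commute)

lemma norm_affine_hJ: "(norm (b *\<^sub>R x + hJ U s x))\<^sup>2 = (b\<^sup>2 + (norm s)\<^sup>2) * (norm x)\<^sup>2"
proof -
  have "(norm (b *\<^sub>R x + hJ U s x))\<^sup>2 = b\<^sup>2 * (norm x)\<^sup>2 + (norm (hJ U s x))\<^sup>2"
    unfolding power2_norm_eq_inner
    by (simp add: inner_add_left inner_add_right power2_eq_square)
  then show ?thesis
    by (simp add: norm_hJ power_mult_distrib algebra_simps)
qed

lemma hform_Jspan:
  assumes "v \<in> Jspan x"
  shows "hform x v = (norm x)\<^sup>2 * (norm v)\<^sup>2"
proof -
  obtain c s where v: "v = c *\<^sub>R x + hJ U s x"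
    using assms by (auto simp: Jspan_def)
  have "x \<bullet> v = c * (norm x)\<^sup>2"
    by (simp add: v inner_add_right power2_norm_eq_inner)
  moreover have "hbr U x v = (norm x)\<^sup>2 *\<^sub>R s"
    by (simp add: v hbr.add_right hbr.scaleR_right hbr_hJ)
  ultimately have "hform x v = (c * (norm x)\<^sup>2)\<^sup>2 + ((norm x)\<^sup>2 * norm s)\<^sup>2"
    by (simp add: hform_def)
  moreover have "(norm v)\<^sup>2 = (c\<^sup>2 + (norm s)\<^sup>2) * (norm x)\<^sup>2"
    by (simp add: v norm_affine_hJ)
  ultimately show ?thesis
    by (simp add: power2_eq_square algebra_simps)
qed

lemma hform_add_orthogonal:
  assumes "\<And>u. u \<in> Jspan x \<Longrightarrow> u \<bullet> w = 0"
  shows "hform x (v + w) = hform x v"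
proof -
  have "x \<bullet> w = 0"
    using assms[of x] JspanI[of 1 x 0] by (simp add: hJ.zero_left)
  moreover have "t \<bullet> hbr U x w = 0" for t
    using assms[OF Jspan_hJ_self] by (simp add: hJ_inner)
  then have "hbr U x w = 0"
    using inner_eq_zero_iff by blast
  ultimately show ?thesis
    by (simp add: hform_def inner_add_right hbr.add_right)
qed

lemma Jspan_decomposition:
  assumes "x \<noteq> 0"
  obtains v w where "y = v + w" "v \<in> Jspan x" "\<And>u. u \<in> Jspan x \<Longrightarrow> u \<bullet> w = 0"
proof
  \<comment> \<open>For t in the standard basis, the vectors x and J_t x are pairwise orthogonal of
    length |x|. So c and the entries of s are the Fourier coefficients of y in this family.\<close>
  define c where "c = (x \<bullet> y) / (norm x)\<^sup>2"
  define s where "s = (1 / (norm x)\<^sup>2) *\<^sub>R hbr U x y"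
  define v where "v = c *\<^sub>R x + hJ U s x"
  show "y = v + (y - v)" by simp
  show "v \<in> Jspan x" by (simp add: v_def JspanI)
  have "x \<bullet> v = x \<bullet> y"
    using assms by (simp add: v_def inner_add_right c_def power2_norm_eq_inner)
  moreover have "hJ U t x \<bullet> v = hJ U t x \<bullet> y" for t
    using assms by (simp add: v_def inner_add_right inner_hJ_hJ s_def) (simp add: hJ_inner)
  ultimately show "u \<bullet> (y - v) = 0" if "u \<in> Jspan x" for u
    using that by (auto simp: Jspan_def inner_add_left inner_diff_right)
qed

text \<open>Projecting onto \<open>Jspan x\<close> does not lengthen y. The case x = 0 is separate
  because the projection divides by |x|^2.\<close>

lemma hform_le: "hform x y \<le> (norm x)\<^sup>2 * (norm y)\<^sup>2"
proof (cases "x = 0")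
  case True
  then show ?thesis by (simp add: hform_def hbr.zero_left)
next
  case False
  obtain v w where vw: "y = v + w" "v \<in> Jspan x" "\<And>u. u \<in> Jspan x \<Longrightarrow> u \<bullet> w = 0"
    using Jspan_decomposition[OF False] by blast
  have "(norm y)\<^sup>2 = (norm v)\<^sup>2 + (norm w)\<^sup>2"
    using vw(3)[OF vw(2)] vw(1)
    by (simp add: power2_norm_eq_inner inner_add_left inner_add_right inner_commute)
  then show ?thesis
    using hform_Jspan[OF vw(2)] hform_add_orthogonal[OF vw(3)] vw(1)
    by (simp add: mult_left_mono)
qed

text \<open>By the Iwasawa condition the span of x and all J_t x is invariant
  under every J_s, hence the orthogonal projection onto it commutes with b - J_s.\<close>

lemma hform_affine_hJ: "hform x (b *\<^sub>R y - hJ U s y) = (b\<^sup>2 + (norm s)\<^sup>2) * hform x y"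
proof (cases "x = 0")
  case True
  then show ?thesis by (simp add: hform_def hbr.zero_left)
next
  case False
  obtain v w where vw: "y = v + w" "v \<in> Jspan x" "\<And>u. u \<in> Jspan x \<Longrightarrow> u \<bullet> w = 0"
    using Jspan_decomposition[OF False] by blast
  define Q where "Q = (\<lambda>y. b *\<^sub>R y + hJ U (- s) y)"
  have Qv: "Q v \<in> Jspan x"
    unfolding Q_def using vw(2) by (intro Jspan_add Jspan_scaleR hJ_Jspan)
  \<comment> \<open>As J_s is skew, the adjoint of b - J_s is b + J_s, which also preserves
    \<open>Jspan x\<close>; hence Q preserves the orthogonal complement.\<close>
  have Qw: "u \<bullet> Q w = 0" if "u \<in> Jspan x" for u
  proof -
    have "u \<bullet> Q w = (b *\<^sub>R u + hJ U s u) \<bullet> w"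
      by (simp add: Q_def inner_add_left inner_diff_right hJ.minus_left hJ_skew[of s u])
    also have "\<dots> = 0"
      using that by (intro vw(3) Jspan_add Jspan_scaleR hJ_Jspan)
    finally show ?thesis .
  qed
  have "Q y = Q v + Q w"
    by (simp add: Q_def vw(1) hJ.add_right algebra_simps)
  then have "hform x (Q y) = (norm x)\<^sup>2 * (norm (Q v))\<^sup>2"
    using hform_add_orthogonal[of x "Q w" "Q v"] Qw hform_Jspan[OF Qv] by simp
  also have "\<dots> = (b\<^sup>2 + (norm s)\<^sup>2) * hform x y"
    using hform_Jspan[OF vw(2)] hform_add_orthogonal[OF vw(3)] vw(1)
    by (simp add: Q_def norm_affine_hJ)
  finally show ?thesis
    by (simp add: Q_def hJ.minus_left)
qed

section \<open>Group law, triangle inequality and its equality case\<close>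

lemma hmul_assoc: "hmul U (hmul U p q) r = hmul U p (hmul U q r)"
  by (simp add: hmul_def hbr.add_left hbr.add_right scaleR_add_right)

lemma hmul_hinv [simp]:
  "hmul U (hinv p) p = 0" "hmul U p (hinv p) = 0"
  "hmul U (hinv p) (hmul U p q) = q" "hmul U p (hmul U (hinv p) q) = q"
  by (simp_all add: hmul_def hinv_def hbr.minus_left hbr.minus_right hbr.add_right hbr.diff_right zero_prod_def)

lemma hmul_0 [simp]: "hmul U 0 p = p" "hmul U p 0 = p"
  by (simp_all add: hmul_def hbr.zero_left hbr.zero_right)

lemma hinv_hmul: "hinv (hmul U p q) = hmul U (hinv q) (hinv p)"
  by (simp add: hmul_def hinv_def hbr.minus_left hbr.minus_right hbr_commute[of "fst q"])

lemma hinv_hinv [simp]: "hinv (hinv p) = p"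
  by (simp add: hinv_def)

lemma gauge_hinv [simp]: "gauge (hinv p) = gauge p"
  by (simp add: gauge_def hinv_def)

lemma hdist_commute: "hdist U p q = hdist U q p"
  unfolding hdist_def by (metis gauge_hinv hinv_hinv hinv_hmul)

lemma hdist_hmul [simp]: "hdist U (hmul U r p) (hmul U r q) = hdist U p q"
  by (simp add: hdist_def hinv_hmul hmul_assoc)

lemma hdist_nonneg [simp]: "0 \<le> hdist U p q"
  by (simp add: hdist_def)

lemma hmul_hinv_eq_0_iff [simp]: "hmul U (hinv p) q = 0 \<longleftrightarrow> p = q"
  by (metis hmul_0(2) hmul_hinv(1,4))

lemma hdist_eq_0_iff [simp]: "hdist U p q = 0 \<longleftrightarrow> p = q"
  by (simp add: hdist_def)

lemma hmul_line: "hmul U (hmul U p (a *\<^sub>R x, 0)) (b *\<^sub>R x, 0) = hmul U p ((a + b) *\<^sub>R x, 0)"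
  by (simp add: hmul_assoc)
     (simp add: hmul_def hbr.scaleR_left hbr.scaleR_right scaleR_add_left)

text \<open>|x + y|^2 contributes 2 <x,y>, and the 1/2 of the group law times 4 contributes 2 [x,y].
  This match, which fixes the 16 in the gauge, lets both parts form one correction vector, bounded
  by \<open>norm_hform\<close>.\<close>

lemma gauge_hmul_power2:
  "(gauge (hmul U p q))\<^sup>2 = norm (((norm (fst p))\<^sup>2, 4 *\<^sub>R snd p) + ((norm (fst q))\<^sup>2, 4 *\<^sub>R snd q)
     + 2 *\<^sub>R (fst p \<bullet> fst q, hbr U (fst p) (fst q)))"
  unfolding gauge_power2
  by (rule arg_cong[where f = norm])
     (simp add: hmul_def power2_norm_eq_inner inner_add_left inner_add_right inner_commute
       scaleR_add_right)

lemma norm_hform: "norm (x \<bullet> y, hbr U x y) \<le> norm x * norm y"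
proof -
  have "norm (x \<bullet> y, hbr U x y) = sqrt (hform x y)"
    by (simp add: norm_Pair hform_def)
  also have "\<dots> \<le> sqrt ((norm x * norm y)\<^sup>2)"
    using hform_le by (simp add: power_mult_distrib)
  finally show ?thesis by simp
qed

lemma gauge_hmul_power2_le:
  "(gauge (hmul U p q))\<^sup>2 \<le> (gauge p)\<^sup>2 + (gauge q)\<^sup>2 + 2 * (norm (fst p) * norm (fst q))"
proof -
  have "(gauge (hmul U p q))\<^sup>2 \<le> norm ((norm (fst p))\<^sup>2, 4 *\<^sub>R snd p)
      + norm ((norm (fst q))\<^sup>2, 4 *\<^sub>R snd q)
      + norm (2 *\<^sub>R (fst p \<bullet> fst q, hbr U (fst p) (fst q)))"
    unfolding gauge_hmul_power2 by (intro norm_triangle_mono order_refl)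
  then show ?thesis
    using norm_hform[of "fst p" "fst q"] unfolding gauge_power2 norm_scaleR by simp
qed

lemma gauge_hmul_le: "gauge (hmul U p q) \<le> gauge p + gauge q"
proof (rule power2_le_imp_le)
  have "norm (fst p) * norm (fst q) \<le> gauge p * gauge q"
    by (intro mult_mono norm_fst_le_gauge) auto
  then show "(gauge (hmul U p q))\<^sup>2 \<le> (gauge p + gauge q)\<^sup>2"
    using gauge_hmul_power2_le[of p q] by (simp add: power2_sum)
qed simp

lemma hdist_triangle: "hdist U p r \<le> hdist U p q + hdist U q r"
proof -
  have "hmul U (hinv p) r = hmul U (hmul U (hinv p) q) (hmul U (hinv q) r)"
    by (simp add: hmul_assoc)
  then show ?thesis
    unfolding hdist_def by (metis gauge_hmul_le)
qed

lemma gauge_eq_norm_fst: "gauge p = norm (fst p) \<Longrightarrow> snd p = 0"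
  using gauge_power4[of p] by simp

text \<open>Equality is possible only if |x| equals the gauge at both points, which makes them
  horizontal. Comparing fourth powers then forces equality in Cauchy-Schwarz.\<close>

lemma gauge_hmul_eqD:
  assumes eq: "gauge (hmul U p q) = gauge p + gauge q" and "p \<noteq> 0" "q \<noteq> 0"
  obtains x c where "x \<noteq> 0" "c > 0" "p = (x, 0)" "q = (c *\<^sub>R x, 0)"
proof -
  have "gauge p > 0" "gauge q > 0"
    using assms by simp_all
  have le: "norm (fst p) \<le> gauge p" "norm (fst q) \<le> gauge q"
    by (rule norm_fst_le_gauge)+
  have ge: "gauge p * gauge q \<le> norm (fst p) * norm (fst q)"
    using gauge_hmul_power2_le[of p q] by (simp add: eq power2_sum)
  have p: "norm (fst p) = gauge p"
  proof (rule ccontr)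
    assume "norm (fst p) \<noteq> gauge p"
    then have "norm (fst p) * norm (fst q) < gauge p * gauge q"
      using le \<open>gauge q > 0\<close>
      by (smt (verit) mult_left_mono mult_strict_right_mono norm_ge_zero)
    then show False using ge by simp
  qed
  have q: "norm (fst q) = gauge q"
    using ge le \<open>gauge p > 0\<close> by (simp add: p)
  define x y where "x = fst p" and "y = fst q"
  have px: "p = (x, 0)" and qy: "q = (y, 0)"
    using gauge_eq_norm_fst[of p] gauge_eq_norm_fst[of q] p q by (simp_all add: prod_eq_iff x_def y_def)
  have xy: "x \<noteq> 0" "y \<noteq> 0"
    using assms px qy by (auto simp: zero_prod_def)
  have "((norm x)\<^sup>2 + (norm y)\<^sup>2 + 2 * (norm x * norm y))\<^sup>2 = ((gauge (hmul U p q))\<^sup>2)\<^sup>2"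
    by (simp only: eq p[symmetric] q[symmetric] x_def y_def power2_sum mult.assoc)
  also have "\<dots> = ((norm x)\<^sup>2 + (norm y)\<^sup>2 + 2 * (x \<bullet> y))\<^sup>2 + 4 * (norm (hbr U x y))\<^sup>2"
    unfolding gauge_hmul_power2 by (simp add: norm_Pair px qy power_mult_distrib)
  also have "\<dots> = ((norm x)\<^sup>2 + (norm y)\<^sup>2)\<^sup>2 + 4 * ((norm x)\<^sup>2 + (norm y)\<^sup>2) * (x \<bullet> y) + 4 * hform x y"
    by (simp add: hform_def power2_eq_square algebra_simps)
  \<comment> \<open>With A = |x|^2 + |y|^2 the chain reads (A + 2|x||y|)^2 = A^2 + 4A <x,y> + 4
    \<open>hform x y\<close>. Bounding \<open>hform\<close> by |x|^2 |y|^2 removes the bracket and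
    leaves a comparison linear in <x,y>.\<close>
  finally have "4 * ((norm x)\<^sup>2 + (norm y)\<^sup>2) * (norm x * norm y)
      \<le> 4 * ((norm x)\<^sup>2 + (norm y)\<^sup>2) * (x \<bullet> y)"
    using hform_le[of x y] by (simp add: power2_eq_square algebra_simps)
  moreover have "0 < 4 * ((norm x)\<^sup>2 + (norm y)\<^sup>2)"
    using xy by (simp add: add_pos_pos)
  ultimately have "norm x * norm y \<le> x \<bullet> y"
    using mult_le_cancel_left_pos by blast
  then have "x \<bullet> y = norm x * norm y"
    using norm_cauchy_schwarz[of x y] by linarith
  then have "norm x *\<^sub>R y = norm y *\<^sub>R x"
    by (simp add: norm_cauchy_schwarz_eq)
  then have "(1 / norm x) *\<^sub>R (norm x *\<^sub>R y) = (1 / norm x) *\<^sub>R (norm y *\<^sub>R x)"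
    by simp
  then have "y = (norm y / norm x) *\<^sub>R x"
    using xy by simp
  then show ?thesis
    using that[of x "norm y / norm x"] xy px qy by simp
qed

lemma hdist_triangle_eqD:
  assumes "hdist U p r = hdist U p q + hdist U q r" "p \<noteq> q" "q \<noteq> r"
  obtains x c where "x \<noteq> 0" "c > 0" "q = hmul U p (x, 0)" "r = hmul U q (c *\<^sub>R x, 0)"
proof -
  have "hmul U (hinv p) r = hmul U (hmul U (hinv p) q) (hmul U (hinv q) r)"
    by (simp add: hmul_assoc)
  then obtain x c where "x \<noteq> 0" "c > 0" "hmul U (hinv p) q = (x, 0)" "hmul U (hinv q) r = (c *\<^sub>R x, 0)"
    using gauge_hmul_eqD[of "hmul U (hinv p) q" "hmul U (hinv q) r"] assms
    unfolding hdist_def hmul_hinv_eq_0_iff by metis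
  then show ?thesis
    using that[of x c] hmul_hinv(4)[of p q] hmul_hinv(4)[of q r] by simp
qed

section \<open>The distance under inversion\<close>

text \<open>The mixed terms with <x,y> and [x,y] are collected into \<open>twist\<close>, since
  inversion exchanges a point with its twist up to scalars; the summands can then be transformed
  separately.\<close>

lemma hdist_power4:
  "hdist U p q ^ 4 = gauge p ^ 4 + gauge q ^ 4
     + 2 * (norm (fst p))\<^sup>2 * (norm (fst q))\<^sup>2 - 32 * (snd p \<bullet> snd q)
     - 4 * (twist U p \<bullet> fst q) - 4 * (fst p \<bullet> twist U q) + 4 * hform (fst p) (fst q)"
proof -
  obtain x t y t' where [simp]: "p = (x, t)" "q = (y, t')"
    by (metis surj_pair)
  have J: "x \<bullet> hJ U t' y = - (t' \<bullet> hbr U x y)" "hJ U t x \<bullet> y = t \<bullet> hbr U x y"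
    using hJ_skew[of t' x y] by (simp_all add: hJ_inner)
  have "hdist U p q ^ 4 = ((gauge (hmul U (hinv p) q))\<^sup>2)\<^sup>2"
    by (simp add: hdist_def)
  also have "\<dots> = ((norm x)\<^sup>2 + (norm y)\<^sup>2 - 2 * (x \<bullet> y))\<^sup>2
      + (norm (4 *\<^sub>R t' - 4 *\<^sub>R t - 2 *\<^sub>R hbr U x y))\<^sup>2"
    unfolding gauge_hmul_power2 by (simp add: hinv_def norm_Pair hbr.minus_left)
  also have "(norm (4 *\<^sub>R t' - 4 *\<^sub>R t - 2 *\<^sub>R hbr U x y))\<^sup>2 =
      16 * (norm t)\<^sup>2 + 16 * (norm t')\<^sup>2 + 4 * (norm (hbr U x y))\<^sup>2 - 32 * (t \<bullet> t')
      - 16 * (t' \<bullet> hbr U x y) + 16 * (t \<bullet> hbr U x y)"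
    by (simp add: power2_norm_eq_inner inner_diff_left inner_diff_right inner_commute algebra_simps)
  finally show ?thesis
    by (simp add: gauge_power4 hform_def twist_def inner_diff_left inner_diff_right J)
       (simp add: power2_eq_square power4_eq_xxxx algebra_simps)
qed

lemma norm_fst_inversion:
  assumes "p \<noteq> 0"
  shows "(norm (fst (inversion U p)))\<^sup>2 = (norm (fst p))\<^sup>2 / gauge p ^ 4"
proof -
  obtain x t where [simp]: "p = (x, t)" by (metis surj_pair)
  have "(norm (twist U p))\<^sup>2 = gauge p ^ 4 * (norm x)\<^sup>2"
    using norm_affine_hJ[of "(norm x)\<^sup>2" x "- 4 *\<^sub>R t"]
    by (simp add: twist_def hJ.minus_left hJ.scaleR_left gauge_power4 power_mult_distrib)
  then show ?thesis
    using assms by (simp add: inversion_def power_divide power2_eq_square)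
qed

lemma gauge_inversion:
  assumes "p \<noteq> 0"
  shows "gauge (inversion U p) = 1 / gauge p"
proof (rule power_eq_imp_eq_base[where n = 4])
  have "gauge (inversion U p) ^ 4 =
      ((norm (fst (inversion U p)))\<^sup>2)\<^sup>2 + 16 * (norm (snd (inversion U p)))\<^sup>2"
    by (simp add: gauge_power4)
  also have "\<dots> = (norm (fst p) ^ 4 + 16 * (norm (snd p))\<^sup>2) / (gauge p ^ 4)\<^sup>2"
    unfolding norm_fst_inversion[OF assms]
    by (simp add: inversion_def power_divide add_divide_distrib)
  also have "\<dots> = gauge p ^ 4 / (gauge p ^ 4)\<^sup>2"
    by (simp only: gauge_power4)
  also have "\<dots> = (1 / gauge p) ^ 4"
    using assms by (simp add: power_divide divide_simps)
  finally show "gauge (inversion U p) ^ 4 = (1 / gauge p) ^ 4" .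
qed auto

lemma inversion_neq_0: "p \<noteq> 0 \<Longrightarrow> inversion U p \<noteq> 0"
  using gauge_inversion[of p] by (metis gauge_eq_0_iff divide_eq_0_iff one_neq_zero)

text \<open>Inversion flips the sign of t, and (|x|^2 + 4 J_t)(|x|^2 - 4 J_t) = |x|^4 + 16 |t|^2. So
  the second twist undoes the first up to a scalar.\<close>

lemma twist_inversion:
  assumes "p \<noteq> 0"
  shows "twist U (inversion U p) = - ((1 / gauge p ^ 4) *\<^sub>R fst p)"
proof -
  obtain x t where [simp]: "p = (x, t)" by (metis surj_pair)
  define a where "a = gauge p ^ 4"
  have a: "a \<noteq> 0" "a = norm x ^ 4 + 16 * (norm t)\<^sup>2"
    using assms by (simp_all add: a_def) (simp add: gauge_power4)
  define P where "P = twist U p"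
  have "(norm x)\<^sup>2 *\<^sub>R P + 4 *\<^sub>R hJ U t P = a *\<^sub>R x"
    by (simp add: P_def twist_def a hJ.diff_right hJ.scaleR_right hJ_hJ_same scaleR_diff_right
        scaleR_add_left scaleR_add_right mult.commute power4_eq_xxxx power2_eq_square)
  then have "- ((1 / a\<^sup>2) *\<^sub>R ((norm x)\<^sup>2 *\<^sub>R P + 4 *\<^sub>R hJ U t P)) = - ((1 / a) *\<^sub>R x)"
    using a(1) by (simp add: power2_eq_square)
  moreover have "inversion U p = (- ((1 / a) *\<^sub>R P), - ((1 / a) *\<^sub>R t))"
    by (simp add: inversion_def P_def a_def)
  ultimately show ?thesis
    unfolding twist_def norm_fst_inversion[OF assms] a_def[symmetric]
    by (simp add: hJ.minus_left hJ.minus_right hJ.scaleR_left hJ.scaleR_right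
        scaleR_add_right power2_eq_square)
qed

lemma inversion_inversion:
  assumes "p \<noteq> 0"
  shows "inversion U (inversion U p) = p"
proof -
  have "inversion U (inversion U p) =
      (- ((gauge p ^ 4) *\<^sub>R (- ((1 / gauge p ^ 4) *\<^sub>R fst p))),
       - ((gauge p ^ 4) *\<^sub>R snd (inversion U p)))"
    unfolding inversion_def[of U "inversion U p"] twist_inversion[OF assms]
    by (simp add: gauge_inversion[OF assms] power_divide)
  then show ?thesis
    using assms by (simp add: inversion_def)
qed

text \<open>\<open>hform_affine_hJ\<close> with b the squared norm of \<open>fst p\<close> and s
  four times \<open>snd p\<close>: then b^2 + |s|^2 is the fourth power of the gauge and cancels one
  of the two such factors in the denominator. Through this term the Iwasawa condition reaches the
  metric.\<close>

lemma hform_inversion: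
  assumes "p \<noteq> 0"
  shows "hform x (fst (inversion U p)) = hform x (fst p) / gauge p ^ 4"
proof -
  have *: "hform x (c *\<^sub>R y) = c\<^sup>2 * hform x y" for c y
    by (simp add: hform_def hbr.scaleR_right power_mult_distrib algebra_simps)
  have "fst (inversion U p) =
      (- 1 / gauge p ^ 4) *\<^sub>R ((norm (fst p))\<^sup>2 *\<^sub>R fst p - hJ U (4 *\<^sub>R snd p) (fst p))"
    by (simp add: inversion_def twist_def hJ.scaleR_left)
  then have "hform x (fst (inversion U p)) = (- 1 / gauge p ^ 4)\<^sup>2 * (gauge p ^ 4 * hform x (fst p))"
    by (simp only: * hform_affine_hJ) (simp add: gauge_power4 power_mult_distrib)
  moreover have "(- 1 / a)\<^sup>2 * (a * b) = b / a" if "a \<noteq> 0" for a b :: real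
    using that by (simp add: power2_eq_square)
  ultimately show ?thesis
    using assms by simp
qed

text \<open>Term by term in \<open>hdist_power4\<close>: the two gauge terms trade places, the two
  twist terms trade places, and everything is divided by the product of the fourth powers of the
  gauges.\<close>

lemma hdist_inversion:
  assumes "p \<noteq> 0" "q \<noteq> 0"
  shows "hdist U (inversion U p) (inversion U q) = hdist U p q / (gauge p * gauge q)"
proof (rule power_eq_imp_eq_base[where n = 4])
  define a b where "a = gauge p ^ 4" and "b = gauge q ^ 4"
  have ab: "a \<noteq> 0" "b \<noteq> 0"
    using assms by (simp_all add: a_def b_def)
  have inv: "fst (inversion U r) = - ((1 / gauge r ^ 4) *\<^sub>R twist U r)"
    "snd (inversion U r) = - ((1 / gauge r ^ 4) *\<^sub>R snd r)" for r
    by (simp_all add: inversion_def)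
  have F: "hform (fst (inversion U p)) (fst (inversion U q)) = hform (fst p) (fst q) / (a * b)"
    using hform_inversion[OF assms(1), of "fst q"]
      hform_inversion[OF assms(2), of "fst (inversion U p)"]
    by (simp add: hform_commute[of _ "fst q"] a_def b_def)
  have "hdist U (inversion U p) (inversion U q) ^ 4 =
      1 / a + 1 / b + 2 * ((norm (fst p))\<^sup>2 / a) * ((norm (fst q))\<^sup>2 / b)
      - 32 * (snd p \<bullet> snd q) / (a * b) - 4 * (fst p \<bullet> twist U q) / (a * b)
      - 4 * (twist U p \<bullet> fst q) / (a * b) + 4 * hform (fst p) (fst q) / (a * b)"
    unfolding hdist_power4[of "inversion U p"] F twist_inversion[OF assms(1)]
      twist_inversion[OF assms(2)] norm_fst_inversion[OF assms(1)] norm_fst_inversion[OF assms(2)]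
      gauge_inversion[OF assms(1)] gauge_inversion[OF assms(2)] power_divide
    unfolding inv a_def[symmetric] b_def[symmetric]
    by (simp add: mult.commute[of b a])
  also have "\<dots> = hdist U p q ^ 4 / (a * b)"
    unfolding hdist_power4[of p] a_def[symmetric] b_def[symmetric]
    using ab by (simp add: divide_simps)
  finally have "hdist U (inversion U p) (inversion U q) ^ 4 = hdist U p q ^ 4 / (a * b)" .
  then show "hdist U (inversion U p) (inversion U q) ^ 4 = (hdist U p q / (gauge p * gauge q)) ^ 4"
    by (simp add: a_def b_def power_divide power_mult_distrib)
qed auto

lemma hdist_inversion_translate:
  assumes "p \<noteq> a" "q \<noteq> a"
  shows "hdist U (inversion U (hmul U (hinv a) p)) (inversion U (hmul U (hinv a) q)) =
    hdist U p q / (hdist U a p * hdist U a q)"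
  using hdist_inversion[of "hmul U (hinv a) p" "hmul U (hinv a) q"] assms
  by (auto simp: hdist_def[of U a])

section \<open>Ptolemy's inequality\<close>

lemma ptolemy_hdist:
  "hdist U a c * hdist U b e \<le> hdist U a b * hdist U c e + hdist U b c * hdist U e a"
\<comment> \<open>The inversion is centred at \<open>a\<close>, so the other points must differ from
  it. If one coincides with \<open>a\<close>, the left side vanishes or both sides agree.\<close>
proof (cases "b = a \<or> c = a \<or> e = a")
  case True
  then show ?thesis
    using hdist_commute[of b a] hdist_commute[of c a] hdist_commute[of e a]
      hdist_eq_0_iff[of a a]
    by (auto simp: mult.commute simp del: hdist_eq_0_iff)
next
  case False
  then have pos: "0 < hdist U a b" "0 < hdist U a c" "0 < hdist U a e"
    by (auto simp: less_le)
  define f where "f = (\<lambda>p. inversion U (hmul U (hinv a) p))"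
  have "hdist U (f b) (f e) \<le> hdist U (f b) (f c) + hdist U (f c) (f e)"
    by (rule hdist_triangle)
  then have "hdist U b e / (hdist U a b * hdist U a e) \<le>
      hdist U b c / (hdist U a b * hdist U a c) + hdist U c e / (hdist U a c * hdist U a e)"
    using False by (simp add: f_def hdist_inversion_translate)
  then show ?thesis
    unfolding hdist_commute[of e a]
    using pos by (simp add: divide_simps del: hdist_eq_0_iff) (simp add: algebra_simps)
qed

lemma dreg_simps [simp]:
  "dreg (hdG U) (Some p) (Some q) = hdist U p q"
  "dreg (hdG U) None (Some q) = 1" "dreg (hdG U) (Some p) None = 1"
  by (simp_all add: dreg_def hdG_def)

text \<open>By distinctness at most one point is infinite. Its factors are 1 in \<open>dreg\<close>,
  so the inequality becomes the triangle inequality for the other three.\<close>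

lemma ptolemaean_hdG: "ptolemaean (hdG U) UNIV"
  unfolding ptolemaean_def
proof (intro ballI impI)
  fix a b c e :: "('m, 'n) hpt option"
  assume "distinct [a, b, c, e]"
  then consider "a = None" | "b = None" | "c = None" | "e = None"
    | "None \<notin> {a, b, c, e}" by auto
  then show "dreg (hdG U) a c * dreg (hdG U) b e \<le>
      dreg (hdG U) a b * dreg (hdG U) c e + dreg (hdG U) b c * dreg (hdG U) e a"
  proof cases
    case 1
    with \<open>distinct _\<close> obtain b' c' e' where "b = Some b'" "c = Some c'" "e = Some e'"
      by (cases b; cases c; cases e) auto
    then show ?thesis
      using 1 hdist_triangle[of b' e' c'] by simp
  next
    case 2
    with \<open>distinct _\<close> obtain a' c' e' where "a = Some a'" "c = Some c'" "e = Some e'"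
      by (cases a; cases c; cases e) auto
    then show ?thesis
      using 2 hdist_triangle[of a' c' e'] by (simp add: hdist_commute[of e'])
  next
    case 3
    with \<open>distinct _\<close> obtain a' b' e' where "a = Some a'" "b = Some b'" "e = Some e'"
      by (cases a; cases b; cases e) auto
    then show ?thesis
      using 3 hdist_triangle[of b' e' a'] by (simp add: hdist_commute[of b' a'] hdist_commute[of e' a'])
  next
    case 4
    with \<open>distinct _\<close> obtain a' b' c' where "a = Some a'" "b = Some b'" "c = Some c'"
      by (cases a; cases b; cases c) auto
    then show ?thesis
      using 4 hdist_triangle[of a' c' b'] by simp
  next
    case 5
    then obtain a' b' c' e' where "a = Some a'" "b = Some b'" "c = Some c'" "e = Some e'"
      by (cases a; cases b; cases c; cases e) auto
    then show ?thesis
      using ptolemy_hdist by simp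
  qed
qed

section \<open>Ptolemaean circles as R-circles\<close>

lemma hmul_left_cancel: "hmul U p q = hmul U p r \<longleftrightarrow> q = r"
  by (metis hmul_hinv(3))

text \<open>Two values of the curve fix the line, and every further value is compared with them by
  \<open>hdist_triangle_eqD\<close>. The coordinate along the line is continuous, unbounded above
  towards u and below towards l, so the intermediate value theorem fills the line.\<close>

lemma geodesic_line:
  fixes \<delta> :: "real \<Rightarrow> ('m, 'n) hpt"
  assumes "l < u" and cont: "continuous_on {l<..<u} \<delta>" and inj: "inj_on \<delta> {l<..<u}"
    and lim_l: "filterlim (\<lambda>t. gauge (\<delta> t)) at_top (at_right l)"
    and lim_u: "filterlim (\<lambda>t. gauge (\<delta> t)) at_top (at_left u)"
    and geo: "\<And>r s t. \<lbrakk>l < r; r < s; s < t; t < u\<rbrakk> \<Longrightarrow>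
      hdist U (\<delta> r) (\<delta> t) = hdist U (\<delta> r) (\<delta> s) + hdist U (\<delta> s) (\<delta> t)"
  obtains q x where "x \<noteq> 0" "\<delta> ` {l<..<u} = range (\<lambda>c. hmul U q (c *\<^sub>R x, 0))"
proof -
  have geoD: "\<exists>y k. y \<noteq> 0 \<and> k > 0 \<and> \<delta> s = hmul U (\<delta> r) (y, 0) \<and> \<delta> t = hmul U (\<delta> s) (k *\<^sub>R y, 0)
      \<and> \<delta> t = hmul U (\<delta> r) ((1 + k) *\<^sub>R y, 0)"
    if rst: "l < r" "r < s" "s < t" "t < u" for r s t
  proof -
    have "\<delta> r \<noteq> \<delta> s" "\<delta> s \<noteq> \<delta> t"
      using rst by (simp_all add: inj_on_eq_iff[OF inj])
    then obtain y k where yk: "y \<noteq> 0" "k > 0" "\<delta> s = hmul U (\<delta> r) (y, 0)"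
        "\<delta> t = hmul U (\<delta> s) (k *\<^sub>R y, 0)"
      by (rule hdist_triangle_eqD[OF geo[OF rst]])
    then show ?thesis
      using hmul_line[of "\<delta> r" 1 y k] by (intro exI[of _ y] exI[of _ k]) simp
  qed
  \<comment> \<open>\<open>t0\<close> gives the origin of the line and \<open>t1\<close> its
    direction; \<open>t2\<close> completes a triple so that the equality case applies to these
    two.\<close>
  define t0 t1 t2 where "t0 = (l + u) / 2" and "t1 = (t0 + u) / 2" and "t2 = (t1 + u) / 2"
  have ts: "l < t0" "t0 < t1" "t1 < t2" "t2 < u"
    using \<open>l < u\<close> by (simp_all add: t0_def t1_def t2_def)
  define q where "q = \<delta> t0"
  obtain x where x: "x \<noteq> 0" "\<delta> t1 = hmul U q (x, 0)"
    using geoD[OF ts] by (auto simp: q_def)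
  \<comment> \<open>The sign of c is recorded because the growth of the gauge controls only
    |c|.\<close>
  have line: "\<exists>c. \<delta> t = hmul U q (c *\<^sub>R x, 0) \<and> (t0 < t \<longrightarrow> 0 < c) \<and> (t < t0 \<longrightarrow> c < 0)"
    if t: "l < t" "t < u" for t
  proof -
    consider "t < t0" | "t = t0" | "t0 < t" "t < t1" | "t = t1" | "t1 < t"
      by linarith
    then show ?thesis
    proof cases
      case 1
      then obtain y k where yk: "k > 0" "q = hmul U (\<delta> t) (y, 0)" "\<delta> t1 = hmul U q (k *\<^sub>R y, 0)"
        using geoD[of t t0 t1] t ts by (auto simp: q_def)
      then have "x = k *\<^sub>R y"
        using x(2) by (simp add: hmul_left_cancel)
      moreover have "\<delta> t = hmul U q ((- 1) *\<^sub>R y, 0)"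
        using hmul_line[of "\<delta> t" 1 y "- 1"] yk(2) by (simp add: zero_prod_def[symmetric])
      ultimately have "\<delta> t = hmul U q ((- 1 / k) *\<^sub>R x, 0)" "- 1 / k < 0"
        using yk(1) by auto
      then show ?thesis using 1 by (intro exI[of _ "- 1 / k"]) simp
    next
      case 2
      then have "\<delta> t = hmul U q (0 *\<^sub>R x, 0)"
        by (simp add: q_def zero_prod_def[symmetric])
      then show ?thesis using 2 by blast
    next
      case 3
      then obtain y k where yk: "k > 0" "\<delta> t = hmul U q (y, 0)" "\<delta> t1 = hmul U q ((1 + k) *\<^sub>R y, 0)"
        using geoD[of t0 t t1] t ts by (auto simp: q_def)
      then have "x = (1 + k) *\<^sub>R y"
        using x(2) by (simp add: hmul_left_cancel)
      then have "\<delta> t = hmul U q ((1 / (1 + k)) *\<^sub>R x, 0)" "1 / (1 + k) > 0"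
        using yk(1,2) by auto
      then show ?thesis using 3 by (intro exI[of _ "1 / (1 + k)"]) simp
    next
      case 4
      then have "\<delta> t = hmul U q (1 *\<^sub>R x, 0)"
        using x by simp
      then show ?thesis using 4 ts by (intro exI[of _ 1]) simp
    next
      case 5
      then obtain y k where yk: "k > 0" "\<delta> t1 = hmul U q (y, 0)" "\<delta> t = hmul U q ((1 + k) *\<^sub>R y, 0)"
        using geoD[of t0 t1 t] t ts by (auto simp: q_def)
      then have "x = y"
        using x(2) by (simp add: hmul_left_cancel)
      then have "\<delta> t = hmul U q ((1 + k) *\<^sub>R x, 0)" "1 + k > 0"
        using yk by auto
      then show ?thesis using 5 ts by (intro exI[of _ "1 + k"]) simp
    qed
  qed
  \<comment> \<open>On the horizontal component the group law is addition, so c is recovered by an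
    inner product; this formula makes its continuity in t visible.\<close>
  define \<kappa> where "\<kappa> = (\<lambda>t. ((fst (\<delta> t) - fst q) \<bullet> x) / (x \<bullet> x))"
  have \<kappa>: "\<delta> t = hmul U q (\<kappa> t *\<^sub>R x, 0)" "t0 < t \<Longrightarrow> 0 < \<kappa> t" "t < t0 \<Longrightarrow> \<kappa> t < 0"
    if t: "l < t" "t < u" for t
  proof -
    obtain c where c: "\<delta> t = hmul U q (c *\<^sub>R x, 0)" "t0 < t \<longrightarrow> 0 < c" "t < t0 \<longrightarrow> c < 0"
      using line[OF t] by blast
    then have "\<kappa> t = c"
      using x(1) by (simp add: \<kappa>_def hmul_def)
    then show "\<delta> t = hmul U q (\<kappa> t *\<^sub>R x, 0)" "t0 < t \<Longrightarrow> 0 < \<kappa> t" "t < t0 \<Longrightarrow> \<kappa> t < 0"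
      using c by auto
  qed
  have cont_\<kappa>: "continuous_on {l<..<u} \<kappa>"
    unfolding \<kappa>_def using x(1) by (intro continuous_intros cont) auto
  have \<kappa>0: "\<kappa> t0 = 0"
    by (simp add: \<kappa>_def q_def)
  have big: "v \<le> \<bar>\<kappa> t\<bar>" if "l < t" "t < u" "gauge q + v * norm x \<le> gauge (\<delta> t)" for t v
  proof -
    have "gauge (\<delta> t) \<le> gauge q + \<bar>\<kappa> t\<bar> * norm x"
      using gauge_hmul_le[of q "(\<kappa> t *\<^sub>R x, 0)"] \<kappa>(1)[OF that(1,2)]
      by (simp add: gauge_scaleR_fst)
    then have "v * norm x \<le> \<bar>\<kappa> t\<bar> * norm x"
      using that(3) by linarith
    then show ?thesis using x(1) by simp
  qed
  have surj: "\<exists>t. l < t \<and> t < u \<and> \<kappa> t = v" for v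
  proof (cases "0 \<le> v")
    case True
    have "eventually (\<lambda>t. gauge q + v * norm x \<le> gauge (\<delta> t)) (at_left u)"
      using lim_u by (simp add: filterlim_at_top)
    moreover have "eventually (\<lambda>t. t \<in> {t0<..<u}) (at_left u)"
      using ts by (intro eventually_at_left_real) auto
    ultimately have "eventually (\<lambda>t. gauge q + v * norm x \<le> gauge (\<delta> t) \<and> t \<in> {t0<..<u}) (at_left u)"
      by (rule eventually_conj)
    then obtain t where t: "gauge q + v * norm x \<le> gauge (\<delta> t)" "t0 < t" "t < u"
      using eventually_happens'[OF trivial_limit_at_left_real] by fastforce
    have "v \<le> \<kappa> t"
      using big[of t v] \<kappa>(2)[of t] t ts by linarith
    then obtain s where "t0 \<le> s" "s \<le> t" "\<kappa> s = v"
      using IVT'[of \<kappa> t0 v t] True \<kappa>0 t ts continuous_on_subset[OF cont_\<kappa>, of "{t0..t}"] by force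
    then show ?thesis using ts t by (intro exI[of _ s]) auto
  next
    case False
    have "eventually (\<lambda>t. gauge q + (- v) * norm x \<le> gauge (\<delta> t)) (at_right l)"
      using lim_l unfolding filterlim_at_top by blast
    moreover have "eventually (\<lambda>t. t \<in> {l<..<t0}) (at_right l)"
      using ts by (intro eventually_at_right_real) auto
    ultimately have "eventually (\<lambda>t. gauge q + (- v) * norm x \<le> gauge (\<delta> t) \<and> t \<in> {l<..<t0}) (at_right l)"
      by (rule eventually_conj)
    then obtain t where t: "gauge q + (- v) * norm x \<le> gauge (\<delta> t)" "l < t" "t < t0"
      using eventually_happens'[OF trivial_limit_at_right_real] by fastforce
    have "\<kappa> t \<le> v"
      using big[of t "- v"] \<kappa>(3)[of t] t ts by linarith
    then obtain s where "t \<le> s" "s \<le> t0" "\<kappa> s = v"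
      using IVT'[of \<kappa> t v t0] False \<kappa>0 t ts continuous_on_subset[OF cont_\<kappa>, of "{t..t0}"] by force
    then show ?thesis using ts t by (intro exI[of _ s]) auto
  qed
  have "\<delta> ` {l<..<u} = range (\<lambda>c. hmul U q (c *\<^sub>R x, 0))"
  proof
    show "\<delta> ` {l<..<u} \<subseteq> range (\<lambda>c. hmul U q (c *\<^sub>R x, 0))"
      using \<kappa>(1) by auto
    show "range (\<lambda>c. hmul U q (c *\<^sub>R x, 0)) \<subseteq> \<delta> ` {l<..<u}"
    proof (rule image_subsetI)
      fix v
      obtain t where "l < t" "t < u" "\<kappa> t = v" using surj by blast
      then show "hmul U q (v *\<^sub>R x, 0) \<in> \<delta> ` {l<..<u}"
        using \<kappa>(1)[of t] by (intro image_eqI[of _ _ t]) auto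
    qed
  qed
  then show ?thesis using that x(1) by blast
qed

lemma hlt_std_Rcircle:
  "hlt U q ` std_Rcircle x = insert None (Some ` range (\<lambda>c. hmul U q (c *\<^sub>R x, 0)))"
proof -
  have "(std_Rcircle x :: ('m, 'n) hpt option set) = insert None (Some ` range (\<lambda>c. (c *\<^sub>R x, 0)))"
    unfolding std_Rcircle_def by blast
  then show ?thesis
    by (simp add: hlt_def image_image)
qed

lemma R_circle_if_ptolemaean_circle:
  assumes S: "ptolemaean_circle (hdG U) S"
  shows "R_circle U S"
proof -
  have circ: "is_circle S"
    using S by (simp add: ptolemaean_circle_def)
  have ptol: "dreg (hdG U) a (\<gamma> s) * dreg (hdG U) (\<gamma> r) (\<gamma> t)
      = dreg (hdG U) a (\<gamma> r) * dreg (hdG U) (\<gamma> s) (\<gamma> t) + dreg (hdG U) (\<gamma> r) (\<gamma> s) * dreg (hdG U) (\<gamma> t) a"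
    if "a \<in> S" "inj_on \<gamma> {0<..<2*pi}" "\<gamma> ` {0<..<2*pi} = S - {a}"
      "\<And>r s t. \<lbrakk>0 < r; r < s; s < t; t < 2*pi\<rbrakk> \<Longrightarrow> separates S a (\<gamma> s) (\<gamma> r) (\<gamma> t)"
      "0 < r" "r < s" "s < t" "t < 2*pi" for a \<gamma> and r s t :: real
  proof -
    have m: "r \<in> {0<..<2*pi}" "s \<in> {0<..<2*pi}" "t \<in> {0<..<2*pi}"
      using that(5-8) by auto
    then have "\<gamma> r \<in> S - {a}" "\<gamma> s \<in> S - {a}" "\<gamma> t \<in> S - {a}"
      using that(3) by blast+
    moreover have "\<gamma> r \<noteq> \<gamma> s" "\<gamma> s \<noteq> \<gamma> t" "\<gamma> r \<noteq> \<gamma> t"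
      using that(5-8) m by (simp_all add: inj_on_eq_iff[OF that(2)])
    ultimately have "distinct [a, \<gamma> r, \<gamma> s, \<gamma> t]" "\<gamma> r \<in> S" "\<gamma> s \<in> S" "\<gamma> t \<in> S"
      by auto
    then show ?thesis
      using S that(1) that(4)[OF that(5-8)] unfolding ptolemaean_circle_def by blast
  qed
  have two_pi: "0 < 2 * pi" by simp
  show ?thesis
  proof (cases "None \<in> S")
    case True
    obtain \<gamma> where \<gamma>: "continuous_map (top_of_set {0..2*pi}) hat_top \<gamma>" "\<gamma> 0 = None" "\<gamma> (2*pi) = None"
      "inj_on \<gamma> {0<..<2*pi}" "\<gamma> ` {0<..<2*pi} = S - {None}"
      "\<And>r s t. \<lbrakk>0 < r; r < s; s < t; t < 2*pi\<rbrakk> \<Longrightarrow> separates S None (\<gamma> s) (\<gamma> r) (\<gamma> t)"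
      using circle_parametrization[OF circ True] by metis
    define \<delta> where "\<delta> = (\<lambda>t. the (\<gamma> t))"
    have \<gamma>\<delta>: "\<gamma> t = Some (\<delta> t)" if "0 < t" "t < 2*pi" for t
    proof -
      have "\<gamma> t \<in> S - {None}" using \<gamma>(5) that by (metis greaterThanLessThan_iff image_eqI)
      then show ?thesis by (auto simp: \<delta>_def)
    qed
    have lim: "filterlim (\<lambda>t. gauge (\<delta> t)) at_top (at_right 0)"
      "filterlim (\<lambda>t. gauge (\<delta> t)) at_top (at_left (2*pi))"
    proof -
      have o: "openin hat_top (- Some ` {p :: ('m, 'n) hpt. gauge p \<le> M})" for M
        by (intro openin_hat_top_compact compact_gauge_le)
      have big: "M \<le> gauge (\<delta> t)" if "\<gamma> t \<in> - Some ` {p. gauge p \<le> M}" "t \<in> {0<..<2*pi}" for M t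
        using that \<gamma>\<delta>[of t] by auto
      have "eventually (\<lambda>t. M \<le> gauge (\<delta> t)) (at_right 0)" for M
      proof -
        have "eventually (\<lambda>t. \<gamma> t \<in> - Some ` {p. gauge p \<le> M}) (at_right 0)"
          by (rule continuous_map_interval_eventually(1)[OF \<gamma>(1) o]) (auto simp: \<gamma>(2))
        moreover have "eventually (\<lambda>t. t \<in> {0<..<2*pi}) (at_right 0)"
          by (rule eventually_at_right_real) simp
        ultimately show ?thesis
          by eventually_elim (use big in blast)
      qed
      then show "filterlim (\<lambda>t. gauge (\<delta> t)) at_top (at_right 0)"
        by (simp add: filterlim_at_top)
      have "eventually (\<lambda>t. M \<le> gauge (\<delta> t)) (at_left (2*pi))" for M
      proof -
        have "eventually (\<lambda>t. \<gamma> t \<in> - Some ` {p. gauge p \<le> M}) (at_left (2*pi))"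
          by (rule continuous_map_interval_eventually(2)[OF \<gamma>(1) o]) (auto simp: \<gamma>(3))
        moreover have "eventually (\<lambda>t. t \<in> {0<..<2*pi}) (at_left (2*pi))"
          by (rule eventually_at_left_real) simp
        ultimately show ?thesis
          by eventually_elim (use big in blast)
      qed
      then show "filterlim (\<lambda>t. gauge (\<delta> t)) at_top (at_left (2*pi))"
        by (simp add: filterlim_at_top)
    qed
    have cont: "continuous_on {0<..<2*pi} \<delta>"
      unfolding \<delta>_def by (rule continuous_on_the_hat_top[OF \<gamma>(1)]) (auto dest!: \<gamma>\<delta>)
    have inj: "inj_on \<delta> {0<..<2*pi}"
    proof (rule inj_onI)
      fix r s :: real assume "r \<in> {0<..<2*pi}" "s \<in> {0<..<2*pi}" "\<delta> r = \<delta> s"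
      then show "r = s" using \<gamma>(4) \<gamma>\<delta>[of r] \<gamma>\<delta>[of s] by (auto simp: inj_on_def)
    qed
    \<comment> \<open>The three factors involving \<open>None\<close> are 1, so Ptolemy's equality
      is additivity of the distance.\<close>
    have geo: "hdist U (\<delta> r) (\<delta> t) = hdist U (\<delta> r) (\<delta> s) + hdist U (\<delta> s) (\<delta> t)"
      if "0 < r" "r < s" "s < t" "t < 2*pi" for r s t
      using ptol[OF True \<gamma>(4,5,6) that] \<gamma>\<delta>[of r] \<gamma>\<delta>[of s] \<gamma>\<delta>[of t] that by simp
    obtain q x where qx: "x \<noteq> 0" "\<delta> ` {0<..<2*pi} = range (\<lambda>c. hmul U q (c *\<^sub>R x, 0))"
      by (rule geodesic_line[OF two_pi cont inj lim]) (blast intro: geo)+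
    have "S = insert None (\<gamma> ` {0<..<2*pi})"
      using True \<gamma>(5) by auto
    also have "\<gamma> ` {0<..<2*pi} = Some ` \<delta> ` {0<..<2*pi}"
      unfolding image_image using \<gamma>\<delta> by (intro image_cong) auto
    also have "insert None \<dots> = (hlt U q \<circ> id) ` std_Rcircle x"
      by (simp add: qx(2) hlt_std_Rcircle)
    finally show ?thesis
      unfolding R_circle_def using qx(1) by (metis sim_id sim_lt)
  next
    case False
    obtain h g where "homeomorphic_maps (subtopology hat_top S) (top_of_set (sphere (0::complex) 1)) h g"
      using circ by (auto simp: is_circle_def homeomorphic_space_def)
    then have "g 1 \<in> S"
      by (auto simp: homeomorphic_maps_def continuous_map_def topspace_hat_top)
    then obtain p where p: "Some p \<in> S"
      using False by (metis not_None_eq)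
    obtain \<gamma> where \<gamma>: "continuous_map (top_of_set {0..2*pi}) hat_top \<gamma>" "\<gamma> 0 = Some p" "\<gamma> (2*pi) = Some p"
      "inj_on \<gamma> {0<..<2*pi}" "\<gamma> ` {0<..<2*pi} = S - {Some p}"
      "\<And>r s t. \<lbrakk>0 < r; r < s; s < t; t < 2*pi\<rbrakk> \<Longrightarrow> separates S (Some p) (\<gamma> s) (\<gamma> r) (\<gamma> t)"
      using circle_parametrization[OF circ p] by metis
    define \<eta> where "\<eta> = (\<lambda>t. hmul U (hinv p) (the (\<gamma> t)))"
    define \<delta> where "\<delta> = (\<lambda>t. inversion U (\<eta> t))"
    have \<gamma>\<eta>: "\<gamma> t = Some (hmul U p (\<eta> t))" "\<eta> t \<noteq> 0" if "0 < t" "t < 2*pi" for t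
    proof -
      have "\<gamma> t \<in> S - {Some p}" using \<gamma>(5) that by (metis greaterThanLessThan_iff image_eqI)
      moreover then obtain r where "\<gamma> t = Some r"
        using False by (cases "\<gamma> t") auto
      ultimately show "\<gamma> t = Some (hmul U p (\<eta> t))" "\<eta> t \<noteq> 0"
        by (auto simp: \<eta>_def)
    qed
    have \<eta>\<delta>: "\<eta> t = inversion U (\<delta> t)" "\<delta> t \<noteq> 0" if "0 < t" "t < 2*pi" for t
      using \<gamma>\<eta>(2)[OF that] by (simp_all add: \<delta>_def inversion_inversion inversion_neq_0)
    have lim: "filterlim (\<lambda>t. gauge (\<delta> t)) at_top (at_right 0)"
      "filterlim (\<lambda>t. gauge (\<delta> t)) at_top (at_left (2*pi))"
    proof -
      \<comment> \<open>Inversion takes the reciprocal of the gauge, so this radius forces a gauge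
        above |M| + 1. The absolute value and the 1 keep the radius positive for every M.\<close>
      define V where "V = (\<lambda>M. {r. gauge (hmul U (hinv p) r) < 1 / (\<bar>M\<bar> + 1)})"
      have o: "openin hat_top (Some ` V M)" for M
        unfolding V_def by (intro openin_hat_top_Some open_Collect_less continuous_intros)
      have pV: "p \<in> V M" for M
        by (simp add: V_def)
      have V: "M \<le> gauge (\<delta> t)" if "\<gamma> t \<in> Some ` V M" "t \<in> {0<..<2*pi}" for M t
      proof -
        have t: "0 < t" "t < 2*pi" using that by auto
        have "gauge (\<eta> t) < 1 / (\<bar>M\<bar> + 1)"
          using that(1) unfolding \<gamma>\<eta>(1)[OF t] V_def
          by (simp add: inj_image_mem_iff)
        moreover have "0 < gauge (\<eta> t)"
          using \<gamma>\<eta>(2)[OF t] by simp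
        ultimately have "\<bar>M\<bar> + 1 < 1 / gauge (\<eta> t)"
          by (simp add: field_simps)
        then show ?thesis
          using \<gamma>\<eta>(2)[OF t] by (simp add: \<delta>_def gauge_inversion)
      qed
      have "eventually (\<lambda>t. M \<le> gauge (\<delta> t)) (at_right 0)" for M
      proof -
        have "eventually (\<lambda>t. \<gamma> t \<in> Some ` V M) (at_right 0)"
          by (rule continuous_map_interval_eventually(1)[OF \<gamma>(1) o]) (auto simp: \<gamma>(2) pV)
        moreover have "eventually (\<lambda>t. t \<in> {0<..<2*pi}) (at_right 0)"
          by (rule eventually_at_right_real) simp
        ultimately show ?thesis
          by eventually_elim (rule V)
      qed
      then show "filterlim (\<lambda>t. gauge (\<delta> t)) at_top (at_right 0)"
        by (simp add: filterlim_at_top)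
      have "eventually (\<lambda>t. M \<le> gauge (\<delta> t)) (at_left (2*pi))" for M
      proof -
        have "eventually (\<lambda>t. \<gamma> t \<in> Some ` V M) (at_left (2*pi))"
          by (rule continuous_map_interval_eventually(2)[OF \<gamma>(1) o]) (auto simp: \<gamma>(3) pV)
        moreover have "eventually (\<lambda>t. t \<in> {0<..<2*pi}) (at_left (2*pi))"
          by (rule eventually_at_left_real) simp
        ultimately show ?thesis
          by eventually_elim (rule V)
      qed
      then show "filterlim (\<lambda>t. gauge (\<delta> t)) at_top (at_left (2*pi))"
        by (simp add: filterlim_at_top)
    qed
    have "continuous_on {0<..<2*pi} (\<lambda>t. the (\<gamma> t))"
      by (rule continuous_on_the_hat_top[OF \<gamma>(1)]) (auto dest!: \<gamma>\<eta>(1))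
    then have cont: "continuous_on {0<..<2*pi} \<delta>"
      unfolding \<delta>_def using \<gamma>\<eta>(2)
      by (intro continuous_on_inversion) (auto simp: \<eta>_def intro!: continuous_intros)
    have inj: "inj_on \<delta> {0<..<2*pi}"
    proof (rule inj_onI)
      fix r s :: real assume "r \<in> {0<..<2*pi}" "s \<in> {0<..<2*pi}" "\<delta> r = \<delta> s"
      then show "r = s"
        using \<gamma>(4) \<gamma>\<eta>(1)[of r] \<gamma>\<eta>(1)[of s] \<eta>\<delta>(1)[of r] \<eta>\<delta>(1)[of s] by (auto simp: inj_on_def)
    qed
    have geo: "hdist U (\<delta> r) (\<delta> t) = hdist U (\<delta> r) (\<delta> s) + hdist U (\<delta> s) (\<delta> t)"
      if rst: "0 < r" "r < s" "s < t" "t < 2*pi" for r s t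
    proof -
      have n: "\<eta> r \<noteq> 0" "\<eta> s \<noteq> 0" "\<eta> t \<noteq> 0"
        using \<gamma>\<eta>(2) rst by auto
      have "hdist U p (hmul U p r') = gauge r'" for r'
        by (simp add: hdist_def)
      then have "gauge (\<eta> s) * hdist U (\<eta> r) (\<eta> t)
          = gauge (\<eta> r) * hdist U (\<eta> s) (\<eta> t) + hdist U (\<eta> r) (\<eta> s) * gauge (\<eta> t)"
        using ptol[OF p \<gamma>(4,5,6) that] \<gamma>\<eta>(1)[of r] \<gamma>\<eta>(1)[of s] \<gamma>\<eta>(1)[of t] rst
        by (simp add: hdist_commute[of _ p])
      \<comment> \<open>Dividing by the product of the three gauges turns each distance between
        values of \<open>\<eta>\<close> into the distance between their inversions.\<close>
      then show ?thesis
        using n by (simp add: \<delta>_def hdist_inversion divide_simps) (simp add: algebra_simps)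
    qed
    obtain q x where qx: "x \<noteq> 0" "\<delta> ` {0<..<2*pi} = range (\<lambda>c. hmul U q (c *\<^sub>R x, 0))"
      by (rule geodesic_line[OF two_pi cont inj lim]) (blast intro: geo)+
    have "S = insert (Some p) (\<gamma> ` {0<..<2*pi})"
      using p \<gamma>(5) by auto
    \<comment> \<open>The inversion is an involution, so it also carries the line back; infinity,
      adjoined to the line, returns as 0 and then as p.\<close>
    also have "\<gamma> ` {0<..<2*pi} = (\<lambda>t. hlt U p (hsig U (Some (\<delta> t)))) ` {0<..<2*pi}"
      using \<gamma>\<eta>(1) \<eta>\<delta> by (intro image_cong) (auto simp: hlt_def hsig_Some)
    also have "insert (Some p) \<dots> = hlt U p ` hsig U ` insert None (Some ` \<delta> ` {0<..<2*pi})"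
      by (simp add: image_image hlt_def) (simp add: hsig_def zero_prod_def[symmetric])
    also have "\<dots> = (hlt U p \<circ> (hsig U \<circ> (hlt U q \<circ> id))) ` std_Rcircle x"
      by (simp only: image_comp[symmetric] qx(2) hlt_std_Rcircle image_id id_apply)
    finally show ?thesis
      unfolding R_circle_def using qx(1) by (metis sim_id sim_lt sim_sig)
  qed
qed

end

theorem theorem1:
  fixes U :: "'n::finite \<Rightarrow> real^'m::finite^'m"
  assumes "htype_iwasawa U"
  shows "ptolemaean (hdG U) UNIV \<and>
         (\<forall>S. ptolemaean_circle (hdG U) S \<longrightarrow> R_circle U S)"
proof -
  interpret iwasawa U
    by (rule iwasawa.intro[OF assms])
  show ?thesis
    using ptolemaean_hdG R_circle_if_ptolemaean_circle by blast
qed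

end
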